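(* Let $1\le m_1<m$ and $H\ge1$ be integers and let $\mathbf{W}_1^1,\ldots,\mathbf{W}_1^H\in\mathbb{R}^{m_1\times m}$ be matrices with orthonormal rows ($\mathbf{W}_1^h(\mathbf{W}_1^h)^{\top}=\mathbf{I}_{m_1}$ for all $h$). Fix any spectral band $0<\alpha\le\beta<\infty$ and consider the subset $\mathcal{X}_{\alpha,\beta}=\{\mathbf{X}\in\mathcal{S}^m_+:\alpha\mathbf{I}\preceq\mathbf{X}\preceq\beta\mathbf{I}\}$. Under the Log-Cholesky metric, the mapping $F:\mathcal{S}^m_+\to\mathcal{S}^{m_1}_+$, $$F(\mathbf{X};\{\mathbf{W}_1^h\}_{h=1}^H)=\mathbb{E}_{\mathrm{LC}}\big(\mathbf{W}_1^1\mathbf{X}(\mathbf{W}_1^1)^{\top},\ldots,\mathbf{W}_1^H\mathbf{X}(\mathbf{W}_1^H)^{\top}\big)=\Phi^{-1}\Big(\frac{1}{H}\sum_{h=1}^H \Phi\big(\mathbf{W}_1^h\mathbf{X}(\mathbf{W}_1^h)^{\top}\big)\Big),$$ is Lipschitz on $\mathcal{X}_{\alpha,\beta}$ with constant $L\le\frac{2\beta^{3/2}}{\alpha}\max\{1,\alpha^{-1}\}$, i.e. $$d_{\mathrm{LC}}(F(\mathbf{X}),F(\mathbf{Z}))\le L\,d_{\mathrm{LC}}(\mathbf{X},\mathbf{Z})\qquad\text{for all }\mathbf{X},\mathbf{Z}\in\mathcal{X}_{\alpha,\beta}.$$ In particular, $F$ is neither contractive nor non-expansive.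
   Context: $\mathcal{S}^n_+$ denotes the set of real symmetric positive definite $n\times n$ matrices and $\preceq$ the Loewner order. For $\mathbf{X}\in\mathcal{S}^n_+$, $\mathfrak{L}(\mathbf{X})$ is its Cholesky factor: the unique lower triangular matrix with positive diagonal such that $\mathbf{X}=\mathfrak{L}(\mathbf{X})\mathfrak{L}(\mathbf{X})^{\top}$. The log-Cholesky coordinate map $\Phi:\mathcal{S}^n_+\to\mathbb{R}^{n(n+1)/2}$ (a bijection, one for each $n$) sends $\mathbf{X}$ to the vector consisting of the strictly lower triangular entries of $\mathfrak{L}(\mathbf{X})$ together with the logarithms of the diagonal entries of $\mathfrak{L}(\mathbf{X})$ (in a fixed order). The Log-Cholesky distance is $d_{\mathrm{LC}}(\mathbf{X},\mathbf{Z})=\|\Phi(\mathbf{X})-\Phi(\mathbf{Z})\|_2$. The Log-Cholesky Fréchet mean $\mathbb{E}_{\mathrm{LC}}(\mathbf{X}_1,\ldots,\mathbf{X}_H)$ is the unique minimizer over $\mathbf{X}$ of $\sum_h d_{\mathrm{LC}}(\mathbf{X},\mathbf{X}_h)^2$. A map $F$ between metric spaces is non-expansive if it is Lipschitz with a constant $L\le1$, and contractive if it is Lipschitz with a constant $L<1$; here the distances are the Log-Cholesky distances.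
   Formalization: "F is not non-expansive" is proved only when some W_1^h has a nonzero entry (i,j) with i≠j; otherwise every W_1^h is [D_h 0] with D_h = diag(±1) and F is non-expansive (e.g. W=[I 0], where F takes the leading block), so the claim fails there. *)

theory Defs
  imports Complex_Main "Jordan_Normal_Form.Matrix"
begin

definition spd :: "nat \<Rightarrow> real mat set" where
  "spd n = {X \<in> carrier_mat n n. transpose_mat X = X \<and>
     (\<forall>v \<in> carrier_vec n. v \<noteq> 0\<^sub>v n \<longrightarrow> 0 < v \<bullet> (X *\<^sub>v v))}"

definition loewner_le :: "nat \<Rightarrow> real mat \<Rightarrow> real mat \<Rightarrow> bool" where
  "loewner_le n A B \<longleftrightarrow> A \<in> carrier_mat n n \<and> B \<in> carrier_mat n n \<and>
     transpose_mat (B - A) = B - A \<and>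
     (\<forall>v \<in> carrier_vec n. 0 \<le> v \<bullet> ((B - A) *\<^sub>v v))"

definition spectral_band :: "nat \<Rightarrow> real \<Rightarrow> real \<Rightarrow> real mat set" where
  "spectral_band n \<alpha> \<beta> =
     {X \<in> spd n. loewner_le n (\<alpha> \<cdot>\<^sub>m 1\<^sub>m n) X \<and> loewner_le n X (\<beta> \<cdot>\<^sub>m 1\<^sub>m n)}"

definition is_cholesky_factor :: "real mat \<Rightarrow> real mat \<Rightarrow> bool" where
  "is_cholesky_factor X L \<longleftrightarrow> L \<in> carrier_mat (dim_row X) (dim_row X) \<and>
     (\<forall>j < dim_row X. \<forall>i < j. L $$ (i, j) = 0) \<and>
     (\<forall>i < dim_row X. 0 < L $$ (i, i)) \<and>
     X = L * transpose_mat L"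

(* Meaningful for X in spd n only, where the factor exists and is unique. *)
definition cholesky :: "real mat \<Rightarrow> real mat" where
  "cholesky X = (THE L. is_cholesky_factor X L)"

(* The coordinate order: strictly lower triangular entries row by row, then the
   logarithms of the diagonal entries. *)
definition log_cholesky :: "real mat \<Rightarrow> real vec" where
  "log_cholesky X = vec_of_list
     ([cholesky X $$ (i, j). i \<leftarrow> [0..<dim_row X], j \<leftarrow> [0..<i]] @
      [ln (cholesky X $$ (i, i)). i \<leftarrow> [0..<dim_row X]])"

(* The inverse of the coordinate map on the n x n matrices. *)
definition log_cholesky_inv :: "nat \<Rightarrow> real vec \<Rightarrow> real mat" where
  "log_cholesky_inv n = inv_into (spd n) log_cholesky"

definition euclidean_norm :: "real vec \<Rightarrow> real" where
  "euclidean_norm v = sqrt (v \<bullet> v)"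

definition dist_LC :: "real mat \<Rightarrow> real mat \<Rightarrow> real" where
  "dist_LC X Z = euclidean_norm (log_cholesky X - log_cholesky Z)"

definition frechet_mean_LC :: "nat \<Rightarrow> nat \<Rightarrow> (nat \<Rightarrow> real mat) \<Rightarrow> real mat" where
  "frechet_mean_LC n H Xs =
     (THE X. is_arg_min (\<lambda>X. \<Sum>h<H. (dist_LC X (Xs h))\<^sup>2) (\<lambda>X. X \<in> spd n) X)"

definition mean_layer :: "nat \<Rightarrow> nat \<Rightarrow> (nat \<Rightarrow> real mat) \<Rightarrow> real mat \<Rightarrow> real mat" where
  "mean_layer m1 H W X = frechet_mean_LC m1 H (\<lambda>h. W h * X * transpose_mat (W h))"

definition lipschitz_LC :: "real \<Rightarrow> real mat set \<Rightarrow> (real mat \<Rightarrow> real mat) \<Rightarrow> bool" where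
  "lipschitz_LC L S F \<longleftrightarrow> 0 \<le> L \<and>
     (\<forall>X \<in> S. \<forall>Z \<in> S. dist_LC (F X) (F Z) \<le> L * dist_LC X Z)"

definition non_expansive_LC :: "real mat set \<Rightarrow> (real mat \<Rightarrow> real mat) \<Rightarrow> bool" where
  "non_expansive_LC S F \<longleftrightarrow> (\<exists>L \<le> 1. lipschitz_LC L S F)"

definition contractive_LC :: "real mat set \<Rightarrow> (real mat \<Rightarrow> real mat) \<Rightarrow> bool" where
  "contractive_LC S F \<longleftrightarrow> (\<exists>L < 1. lipschitz_LC L S F)"

end

theory Submission
  imports Defs "Jordan_Normal_Form.Determinant" "HOL-Analysis.L2_Norm"
begin

text \<open>In log-Cholesky coordinates the Frechet mean is the arithmetic mean, so the Lipschitz bound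
  reduces to a single compression \<open>X \<mapsto> W X W\<^sup>T\<close>, which does not increase the Frobenius norm and
  preserves the band. On the band the coordinates are compared with the Frobenius norm in both
  directions: \<open>X - Z = (L - M) L\<^sup>T + M (L - M)\<^sup>T\<close> bounds \<open>X - Z\<close> by the coordinates, and a
  first-order perturbation estimate for the Cholesky factor, summed along the segment between two
  matrices, bounds the coordinates by the difference of the matrices. For the negative part, let
  \<open>i\<close> be the first row in which some \<open>W h\<close> is not diagonal. On suitable inputs the \<open>i\<close>-th diagonal
  coordinate of \<open>F\<close> is the mean over \<open>h\<close> of \<open>ln (norm (L\<^sup>T w h))\<close> with \<open>w h\<close> the \<open>i\<close>-th row, and letting
  \<open>L\<^sup>T w h\<close> tend to \<open>0\<close> for one \<open>h\<close> makes its derivative unbounded. If there is no such row, \<open>F\<close> is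
  isometric in the first diagonal coordinate.\<close>

section \<open>Cholesky factors\<close>

text \<open>The obstacle is the constant. At \<alpha> = \<beta> = 1 the product of the two
  comparison constants, \<open>sqrt ((\<beta> + 1) / 2) / \<alpha>\<close> and
  \<open>2 * sqrt \<beta> * sqrt (max 1 \<beta>)\<close>, equals the claimed bound, so neither
  estimate can afford a further loss. The half under the first root comes from triangularity:
  symmetrising a lower triangular matrix multiplies its Frobenius norm by at least
  \<open>sqrt 2\<close>. The term \<beta> in \<open>\<beta> + 1\<close> is the price of the entries
  of the factor, the term 1 that of the logarithms on its diagonal. The first-order estimate has
  this constant only in the limit of small perturbations. It is therefore used on short steps, with
  a loss factor that tends to 1. How short the steps must be is decided by a second, crude
  perturbation bound, whose constant \<open>C\<close> never enters the Lipschitz constant. The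
  negative statements concern the whole cone: their test matrices depend on a parameter that leaves
  every band, and the bound on a band is no contradiction to them.\<close>

lemma cholesky_exists_fun:
  fixes x :: "nat \<Rightarrow> nat \<Rightarrow> real"
  assumes "\<And>i j. i < n \<Longrightarrow> j < n \<Longrightarrow> x i j = x j i"
    and "\<And>v. \<exists>i<n. v i \<noteq> 0 \<Longrightarrow> 0 < (\<Sum>i<n. \<Sum>j<n. v i * x i j * v j)"
  shows "\<exists>l. (\<forall>i j. i < j \<longrightarrow> l i j = 0) \<and> (\<forall>i<n. 0 < l i i) \<and>
    (\<forall>i<n. \<forall>j<n. x i j = (\<Sum>k<n. l i k * l j k))"
  using assms
\<comment> \<open>Induction on the size, eliminating the first row and column. With functions on
  \<open>nat\<close>, passing to the smaller problem is an index shift by \<open>Suc\<close> and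
  needs no block matrices.\<close>
proof (induction n arbitrary: x)
  case 0
  show ?case by (rule exI[of _ "\<lambda>_ _. 0"]) simp
next
  case (Suc n)
  note sym = Suc.prems(1) and pos = Suc.prems(2)
  define a where "a = x 0 0"
  have a: "0 < a"
  proof -
    have "0 < (\<Sum>i<Suc n. \<Sum>j<Suc n. of_bool (i = 0) * x i j * (of_bool (j = 0)::real))"
      by (rule pos) (auto intro!: exI[of _ 0])
    then show ?thesis
      by (simp add: a_def sum.lessThan_Suc_shift del: sum.lessThan_Suc)
  qed
  \<comment> \<open>the Schur complement of the leading entry\<close>
  define y where "y i j = x (Suc i) (Suc j) - x (Suc i) 0 * x (Suc j) 0 / a" for i j
  have "\<exists>l. (\<forall>i j. i < j \<longrightarrow> l i j = 0) \<and> (\<forall>i<n. 0 < l i i) \<and>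
    (\<forall>i<n. \<forall>j<n. y i j = (\<Sum>k<n. l i k * l j k))"
  proof (rule Suc.IH)
    show "y i j = y j i" if "i < n" "j < n" for i j
      using that sym[of "Suc i" "Suc j"] by (simp add: y_def mult.commute)
    fix v :: "nat \<Rightarrow> real"
    assume v: "\<exists>i<n. v i \<noteq> 0"
    define b where "b = (\<Sum>i<n. x (Suc i) 0 * v i)"
    \<comment> \<open>The first entry \<open>- b / a\<close> minimises the form of \<open>x\<close>
      over all extensions of \<open>v\<close>. The minimum is the form of the Schur complement at
      \<open>v\<close>, which is therefore positive.\<close>
    define u where "u i = (case i of 0 \<Rightarrow> - b / a | Suc i \<Rightarrow> v i)" for i
    have "0 < (\<Sum>i<Suc n. \<Sum>j<Suc n. u i * x i j * u j)"
    proof (rule pos)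
      from v obtain i where "i < n" "v i \<noteq> 0" by blast
      then show "\<exists>i<Suc n. u i \<noteq> 0" by (intro exI[of _ "Suc i"]) (simp add: u_def)
    qed
    also have "\<dots> = b\<^sup>2 / a + (\<Sum>j<n. (- b / a) * x 0 (Suc j) * v j)
        + (\<Sum>i<n. v i * x (Suc i) 0 * (- b / a) + (\<Sum>j<n. v i * x (Suc i) (Suc j) * v j))"
      using a by (simp add: sum.lessThan_Suc_shift u_def a_def power2_eq_square del: sum.lessThan_Suc)
    also have "(\<Sum>j<n. (- b / a) * x 0 (Suc j) * v j) = (- b / a) * b"
    proof -
      have "(- b / a) * b = (\<Sum>j<n. (- b / a) * (x (Suc j) 0 * v j))"
        by (subst (2) b_def) (rule sum_distrib_left)
      then show ?thesis using sym by (simp add: mult.assoc)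
    qed
    also have "(\<Sum>i<n. v i * x (Suc i) 0 * (- b / a) + (\<Sum>j<n. v i * x (Suc i) (Suc j) * v j))
       = (- b / a) * b + (\<Sum>i<n. \<Sum>j<n. v i * x (Suc i) (Suc j) * v j)"
    proof -
      have "(\<Sum>i<n. v i * x (Suc i) 0 * (- b / a)) = b * (- b / a)"
        by (subst (2) b_def) (simp only: sum_distrib_left mult_ac)
      then show ?thesis by (simp only: sum.distrib mult.commute)
    qed
    also have "b\<^sup>2 / a + (- b / a) * b + ((- b / a) * b + (\<Sum>i<n. \<Sum>j<n. v i * x (Suc i) (Suc j) * v j))
      = (\<Sum>i<n. \<Sum>j<n. v i * x (Suc i) (Suc j) * v j) - b * b / a"
      by (simp add: power2_eq_square)
    also have "b * b / a = (\<Sum>i<n. \<Sum>j<n. v i * (x (Suc i) 0 * x (Suc j) 0 / a) * v j)"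
      unfolding b_def sum_product sum_divide_distrib by (intro sum.cong refl) (simp add: mult_ac)
    also have "(\<Sum>i<n. \<Sum>j<n. v i * x (Suc i) (Suc j) * v j)
        - (\<Sum>i<n. \<Sum>j<n. v i * (x (Suc i) 0 * x (Suc j) 0 / a) * v j)
      = (\<Sum>i<n. \<Sum>j<n. v i * y i j * v j)"
      unfolding sum_subtractf[symmetric] y_def
      by (intro sum.cong refl) (simp add: algebra_simps)
    finally show "0 < (\<Sum>i<n. \<Sum>j<n. v i * y i j * v j)" .
  qed
  then obtain l where l0: "\<And>i j. i < j \<Longrightarrow> l i j = 0" and lp: "\<And>i. i < n \<Longrightarrow> 0 < l i i"
    and ly: "\<And>i j. i < n \<Longrightarrow> j < n \<Longrightarrow> y i j = (\<Sum>k<n. l i k * l j k)"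
    by blast
  define k where "k i j = (case i of 0 \<Rightarrow> (case j of 0 \<Rightarrow> sqrt a | Suc _ \<Rightarrow> 0)
     | Suc i' \<Rightarrow> (case j of 0 \<Rightarrow> x i 0 / sqrt a | Suc j' \<Rightarrow> l i' j'))" for i j
  have "x i j = (\<Sum>q<Suc n. k i q * k j q)" if "i < Suc n" "j < Suc n" for i j
    using that a sym[of 0 j]
    by (cases i; cases j)
      (auto simp: sum.lessThan_Suc_shift k_def a_def simp flip: ly simp del: sum.lessThan_Suc,
        auto simp: y_def a_def)
  moreover have "k i j = 0" if "i < j" for i j
    using that l0 by (auto simp: k_def split: nat.splits)
  moreover have "0 < k i i" if "i < Suc n" for i
    using that lp a by (auto simp: k_def split: nat.splits)
  ultimately show ?case by blast
qed

text \<open>Forward substitution by columns: once the earlier columns are known to be close,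
  division by a diagonal entry, which is at least \<open>a\<close>, controls the next one.
  \<open>C\<close> depends only on \<open>n\<close>, \<open>a\<close> and \<open>b\<close>, hence is
  uniform in the two factors: \<epsilon> = 0 gives uniqueness of the factor, small \<epsilon> its
  uniform continuity.\<close>

lemma cholesky_perturbation_fun:
  fixes a b :: real and n :: nat
  assumes a: "0 < a" and b: "0 \<le> b"
  obtains C where "0 \<le> C"
    "\<And>l m \<epsilon> i j. \<lbrakk>0 \<le> \<epsilon>; \<And>i j. i < n \<Longrightarrow> j < n \<Longrightarrow> i < j \<Longrightarrow> l i j = 0 \<and> m i j = 0;
      \<And>i. i < n \<Longrightarrow> a \<le> l i i \<and> a \<le> m i i;
      \<And>i j. i < n \<Longrightarrow> j < n \<Longrightarrow> \<bar>l i j\<bar> \<le> b \<and> \<bar>m i j\<bar> \<le> b;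
      \<And>i j. i < n \<Longrightarrow> j < n \<Longrightarrow>
        \<bar>(\<Sum>k<n. l i k * l j k) - (\<Sum>k<n. m i k * m j k)\<bar> \<le> \<epsilon>;
      i < n; j < n\<rbrakk> \<Longrightarrow> \<bar>l i j - m i j\<bar> \<le> C * \<epsilon>"
proof -
  define H where "H l m \<epsilon> \<longleftrightarrow> 0 \<le> \<epsilon> \<and>
    (\<forall>i<n. \<forall>j<n. i < j \<longrightarrow> l i j = 0 \<and> m i j = 0) \<and>
    (\<forall>i<n. a \<le> l i i \<and> a \<le> m i i) \<and>
    (\<forall>i<n. \<forall>j<n. \<bar>l i j\<bar> \<le> b \<and> \<bar>m i j\<bar> \<le> b) \<and>
    (\<forall>i<n. \<forall>j<n. \<bar>(\<Sum>k<n. l i k * l j k) - (\<Sum>k<n. m i k * m j k)\<bar> \<le> \<epsilon>)" for l m and \<epsilon> :: real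
  have "c \<le> n \<Longrightarrow> \<exists>C\<ge>0. \<forall>l m \<epsilon>. H l m \<epsilon> \<longrightarrow> (\<forall>i<n. \<forall>j<c. \<bar>l i j - m i j\<bar> \<le> C * \<epsilon>)" for c
  proof (induction c)
    case 0
    show ?case by (rule exI[of _ 0]) simp
  next
    case (Suc c)
    then obtain C where C: "0 \<le> C"
      and IH: "\<And>l m \<epsilon> i j. H l m \<epsilon> \<Longrightarrow> i < n \<Longrightarrow> j < c \<Longrightarrow> \<bar>l i j - m i j\<bar> \<le> C * \<epsilon>"
      by (auto simp: Suc_le_eq)
    from Suc.prems have c: "c < n" by simp
    \<comment> \<open>\<open>C1\<close> bounds the change of \<open>l i c * l c c\<close>: 1 for the
      entry of the product matrix and \<open>2 * b * C\<close> for each of the \<open>c\<close>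
      earlier products. \<open>C2\<close> divides a difference of squares by
      \<open>l c c + m c c\<close>, at least \<open>2 * a\<close>. \<open>C3\<close> isolates
      \<open>l i c\<close>, paying \<open>b * C2\<close> for the change of the diagonal
      entry.\<close>
    define C1 where "C1 = 1 + real c * (2 * b * C)"
    define C2 where "C2 = C1 / (2 * a)"
    define C3 where "C3 = (C1 + b * C2) / a"
    have C1: "0 \<le> C1" using b C by (simp add: C1_def)
    have C2: "0 \<le> C2" using C1 a by (simp add: C2_def)
    have C3: "0 \<le> C3" using C1 C2 a b by (simp add: C3_def)
    have "\<bar>l i j - m i j\<bar> \<le> (C + C3) * \<epsilon>"
      if h: "H l m \<epsilon>" and i: "i < n" and j: "j < Suc c" for l m \<epsilon> i j
    proof -
      from h have e: "0 \<le> \<epsilon>" and z: "\<And>i j. i < n \<Longrightarrow> j < n \<Longrightarrow> i < j \<Longrightarrow> l i j = 0 \<and> m i j = 0"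
        and d: "\<And>i. i < n \<Longrightarrow> a \<le> l i i \<and> a \<le> m i i"
        and bd: "\<And>i j. i < n \<Longrightarrow> j < n \<Longrightarrow> \<bar>l i j\<bar> \<le> b \<and> \<bar>m i j\<bar> \<le> b"
        and ne: "\<And>i j. i < n \<Longrightarrow> j < n \<Longrightarrow>
          \<bar>(\<Sum>k<n. l i k * l j k) - (\<Sum>k<n. m i k * m j k)\<bar> \<le> \<epsilon>"
        by (auto simp: H_def)
      show ?thesis
      proof (cases "j = c")
        case False
        then have "\<bar>l i j - m i j\<bar> \<le> C * \<epsilon>" using IH[OF h i] j by simp
        also have "\<dots> \<le> (C + C3) * \<epsilon>" using e C3 by (intro mult_right_mono) auto
        finally show ?thesis .
      next
        case jc: True
        have prod: "\<bar>l i c * l c c - m i c * m c c\<bar> \<le> C1 * \<epsilon>" if i: "i < n" for i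
        proof -
          have s: "(\<Sum>k<n. f i k * f c k) = (\<Sum>k<c. f i k * f c k) + f i c * f c c"
            if "f = l \<or> f = m" for f :: "nat \<Rightarrow> nat \<Rightarrow> real"
          proof -
            have "(\<Sum>k<n. f i k * f c k) = (\<Sum>k<Suc c. f i k * f c k)"
              using c z that by (intro sum.mono_neutral_right) auto
            then show ?thesis by simp
          qed
          have "\<bar>\<Sum>k<c. l i k * l c k - m i k * m c k\<bar> \<le> (\<Sum>k<c. 2 * b * C * \<epsilon>)"
          proof (rule order_trans[OF sum_abs sum_mono])
            fix k assume k: "k \<in> {..<c}"
            have "l i k * l c k - m i k * m c k
              = (l i k - m i k) * l c k + m i k * (l c k - m c k)"
              by (simp add: algebra_simps)
            also have "\<bar>\<dots>\<bar> \<le> \<bar>l i k - m i k\<bar> * \<bar>l c k\<bar> + \<bar>m i k\<bar> * \<bar>l c k - m c k\<bar>"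
              by (metis abs_mult abs_triangle_ineq)
            also have "\<dots> \<le> (C * \<epsilon>) * b + b * (C * \<epsilon>)"
              using IH[OF h, of _ k] bd[of _ k] k c i e b C by (intro add_mono mult_mono) auto
            finally show "\<bar>l i k * l c k - m i k * m c k\<bar> \<le> 2 * b * C * \<epsilon>" by (simp add: mult_ac)
          qed
          moreover have "\<bar>(\<Sum>k<c. l i k * l c k - m i k * m c k) + (l i c * l c c - m i c * m c c)\<bar> \<le> \<epsilon>"
            using ne[OF i c] s[of l] s[of m] by (simp add: sum_subtractf algebra_simps)
          ultimately show ?thesis by (simp add: C1_def algebra_simps)
        qed
        have lc: "a \<le> l c c" "a \<le> m c c" using d c by auto
        have dc: "\<bar>l c c - m c c\<bar> \<le> C2 * \<epsilon>"
        proof -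
          have "\<bar>l c c - m c c\<bar> * (2 * a) \<le> \<bar>l c c - m c c\<bar> * (l c c + m c c)"
            using lc by (intro mult_left_mono) auto
          also have "\<dots> = \<bar>l c c * l c c - m c c * m c c\<bar>"
            using lc a by (simp add: abs_mult square_diff_square_factored)
          also have "\<dots> \<le> C1 * \<epsilon>" using prod c by blast
          finally show ?thesis using a by (simp add: C2_def field_simps)
        qed
        have "\<bar>l i c - m i c\<bar> * a \<le> \<bar>l i c - m i c\<bar> * l c c"
          using lc by (intro mult_left_mono) auto
        also have "\<dots> = \<bar>(l i c * l c c - m i c * m c c) - m i c * (l c c - m c c)\<bar>"
        proof -
          have "\<bar>l i c - m i c\<bar> * l c c = \<bar>(l i c - m i c) * l c c\<bar>" using lc a by (simp add: abs_mult)
          then show ?thesis by (simp add: algebra_simps)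
        qed
        also have "\<dots> \<le> C1 * \<epsilon> + b * (C2 * \<epsilon>)"
        proof (rule order_trans[OF abs_triangle_ineq4 add_mono])
          show "\<bar>m i c * (l c c - m c c)\<bar> \<le> b * (C2 * \<epsilon>)"
            unfolding abs_mult using bd[OF i c] dc b by (intro mult_mono) auto
        qed (use prod i in auto)
        finally have "\<bar>l i c - m i c\<bar> \<le> C3 * \<epsilon>" using a by (simp add: C3_def field_simps)
        also have "\<dots> \<le> (C + C3) * \<epsilon>" using e C by (intro mult_right_mono) auto
        finally show ?thesis using jc by simp
      qed
    qed
    then show ?case using C C3 by (intro exI[of _ "C + C3"]) auto
  qed
  from this[of n] obtain C where C: "0 \<le> C"
    "\<And>l m \<epsilon> i j. H l m \<epsilon> \<Longrightarrow> i < n \<Longrightarrow> j < n \<Longrightarrow> \<bar>l i j - m i j\<bar> \<le> C * \<epsilon>"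
    by auto
  show thesis
    by (rule that[OF C(1)], rule C(2)) (auto simp: H_def)
qed

section \<open>Existence, uniqueness and perturbation of the factor for matrices\<close>

lemma mult_transpose_index:
  assumes "A \<in> carrier_mat n k" "B \<in> carrier_mat m k" "i < n" "j < m"
  shows "(A * transpose_mat B) $$ (i, j) = (\<Sum>l<k. A $$ (i, l) * B $$ (j, l))"
  using assms by (simp add: scalar_prod_def atLeast0LessThan)

lemma mult_index:
  assumes "A \<in> carrier_mat n k" "B \<in> carrier_mat k m" "i < n" "j < m"
  shows "(A * B) $$ (i, j) = (\<Sum>l<k. A $$ (i, l) * B $$ (l, j))"
  using assms by (simp add: scalar_prod_def atLeast0LessThan)

lemma scalar_prod_self_nonneg: "0 \<le> v \<bullet> (v :: real vec)"
  by (simp add: scalar_prod_def sum_nonneg)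

lemma scalar_prod_self_eq_0:
  assumes "v \<in> carrier_vec n" "v \<bullet> v = (0 :: real)"
  shows "v = 0\<^sub>v n"
proof (rule eq_vecI)
  fix i assume "i < dim_vec (0\<^sub>v n :: real vec)"
  moreover have "\<forall>i\<in>{0..<n}. v $ i * v $ i = 0"
    using assms by (subst sum_nonneg_eq_0_iff[symmetric]) (auto simp: scalar_prod_def)
  ultimately show "v $ i = 0\<^sub>v n $ i" by auto
qed (use assms in auto)

lemma quadratic_form_eq:
  assumes "X \<in> carrier_mat n n" "v \<in> carrier_vec n"
  shows "v \<bullet> (X *\<^sub>v v) = (\<Sum>i<n. \<Sum>j<n. v $ i * X $$ (i, j) * (v $ j :: real))"
  using assms by (auto simp: scalar_prod_def atLeast0LessThan sum_distrib_left mult.assoc intro!: sum.cong)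

lemma gram_quadratic_form:
  assumes "L \<in> carrier_mat n k" "v \<in> carrier_vec n"
  shows "v \<bullet> (L * transpose_mat L *\<^sub>v v)
    = (transpose_mat L *\<^sub>v v) \<bullet> (transpose_mat L *\<^sub>v (v :: real vec))"
proof -
  have "v \<bullet> (L * transpose_mat L *\<^sub>v v) = v \<bullet> (L *\<^sub>v (transpose_mat L *\<^sub>v v))"
    using assms by simp
  also have "\<dots> = (transpose_mat L *\<^sub>v v) \<bullet> (transpose_mat L *\<^sub>v v)"
    using assms by (intro transpose_vec_mult_scalar[symmetric]) auto
  finally show ?thesis .
qed

definition lower_pos :: "nat \<Rightarrow> real mat set" where
  "lower_pos n = {L \<in> carrier_mat n n.
     (\<forall>j<n. \<forall>i<j. L $$ (i, j) = 0) \<and> (\<forall>i<n. 0 < L $$ (i, i))}"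

lemma lower_posD:
  assumes "L \<in> lower_pos n"
  shows "L \<in> carrier_mat n n" "\<And>i j. i < j \<Longrightarrow> j < n \<Longrightarrow> L $$ (i, j) = 0"
    "\<And>i. i < n \<Longrightarrow> 0 < L $$ (i, i)"
  using assms by (auto simp: lower_pos_def)

lemma is_cholesky_factor_iff:
  "X \<in> carrier_mat n n \<Longrightarrow>
    is_cholesky_factor X L \<longleftrightarrow> L \<in> lower_pos n \<and> X = L * transpose_mat L"
  by (auto simp: is_cholesky_factor_def lower_pos_def)

lemma lower_pos_inverse:
  assumes L: "L \<in> lower_pos n"
  obtains N where "N \<in> carrier_mat n n" "N * L = 1\<^sub>m n" "L * N = 1\<^sub>m n"
proof -
  note Lc = lower_posD[OF L]
  have "det L = prod_list (diag_mat L)"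
    using Lc by (intro det_lower_triangular[of n]) auto
  also have "\<dots> \<noteq> 0" using Lc by (auto simp: diag_mat_def prod_list_zero_iff less_le)
  finally have "L \<in> Units (ring_mat TYPE(real) n ())"
    using Lc by (intro det_non_zero_imp_unit) auto
  then show ?thesis using that by (auto simp: Units_def ring_mat_def)
qed

lemma transpose_inverse:
  assumes "L \<in> carrier_mat n n" "N \<in> carrier_mat n n" "L * N = (1\<^sub>m n :: real mat)"
  shows "transpose_mat N * transpose_mat L = 1\<^sub>m n"
  using assms by (metis transpose_mult transpose_one)

lemma lower_pos_mult_transpose_spd:
  assumes L: "L \<in> lower_pos n"
  shows "L * transpose_mat L \<in> spd n"
proof -
  note Lc = lower_posD(1)[OF L]
  obtain N where N: "N \<in> carrier_mat n n" "L * N = 1\<^sub>m n" using lower_pos_inverse[OF L] .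
  have "0 < v \<bullet> (L * transpose_mat L *\<^sub>v v)" if v: "v \<in> carrier_vec n" "v \<noteq> 0\<^sub>v n" for v
  proof -
    have "transpose_mat L *\<^sub>v v \<noteq> 0\<^sub>v n"
    proof
      assume "transpose_mat L *\<^sub>v v = 0\<^sub>v n"
      then have "transpose_mat N *\<^sub>v (transpose_mat L *\<^sub>v v) = 0\<^sub>v n" using N by auto
      moreover have "transpose_mat N *\<^sub>v (transpose_mat L *\<^sub>v v) = v"
        using transpose_inverse[OF Lc N] Lc N v
        by (subst assoc_mult_mat_vec[symmetric, of _ n n _ n]) auto
      ultimately show False using v by simp
    qed
    then have "(transpose_mat L *\<^sub>v v) \<bullet> (transpose_mat L *\<^sub>v v) \<noteq> 0"
      using scalar_prod_self_eq_0[OF mult_mat_vec_carrier[of "transpose_mat L" n n v]] Lc v by auto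
    then show ?thesis
      using scalar_prod_self_nonneg[of "transpose_mat L *\<^sub>v v"]
      by (simp add: gram_quadratic_form[OF Lc v(1)] less_le del: scalar_prod_self_nonneg)
  qed
  then show ?thesis using Lc by (auto simp: spd_def transpose_mult[of L n n "transpose_mat L" n])
qed

lemma spdD:
  assumes "X \<in> spd n"
  shows "X \<in> carrier_mat n n" "transpose_mat X = X"
    "\<And>v. v \<in> carrier_vec n \<Longrightarrow> v \<noteq> 0\<^sub>v n \<Longrightarrow> 0 < v \<bullet> (X *\<^sub>v v)"
  using assms by (auto simp: spd_def)

lemma spd_cholesky_exists:
  assumes X: "X \<in> spd n"
  obtains L where "L \<in> lower_pos n" "X = L * transpose_mat L"
proof -
  note Xc = spdD[OF X]
  have "\<exists>l. (\<forall>i j. i < j \<longrightarrow> l i j = 0) \<and> (\<forall>i<n. 0 < l i i) \<and>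
    (\<forall>i<n. \<forall>j<n. X $$ (i, j) = (\<Sum>k<n. l i k * l j k))"
  proof (rule cholesky_exists_fun)
    show "X $$ (i, j) = X $$ (j, i)" if "i < n" "j < n" for i j
      using that Xc(1,2) by (metis carrier_matD index_transpose_mat(1))
    fix v :: "nat \<Rightarrow> real" assume "\<exists>i<n. v i \<noteq> 0"
    then have "vec n v \<noteq> 0\<^sub>v n" by (metis index_vec index_zero_vec(1))
    then have "0 < vec n v \<bullet> (X *\<^sub>v vec n v)" using Xc by simp
    then show "0 < (\<Sum>i<n. \<Sum>j<n. v i * X $$ (i, j) * v j)"
      using quadratic_form_eq[OF Xc(1), of "vec n v"] by simp
  qed
  then obtain l where l: "\<And>i j. i < j \<Longrightarrow> l i j = 0" "\<And>i. i < n \<Longrightarrow> 0 < l i i"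
    "\<And>i j. i < n \<Longrightarrow> j < n \<Longrightarrow> X $$ (i, j) = (\<Sum>k<n. l i k * l j k)" by blast
  define L where "L = mat n n (\<lambda>(i, j). l i j)"
  have "L \<in> lower_pos n" using l by (auto simp: L_def lower_pos_def)
  moreover have "X = L * transpose_mat L"
    using Xc(1) by (intro eq_matI) (auto simp: L_def l(3) scalar_prod_def atLeast0LessThan)
  ultimately show ?thesis using that by blast
qed

lemma cholesky_perturbation:
  fixes a b :: real
  assumes a: "0 < a" and b: "0 \<le> b"
  obtains C where "0 \<le> C"
    "\<And>L M \<epsilon> i j. \<lbrakk>L \<in> lower_pos n; M \<in> lower_pos n; 0 \<le> \<epsilon>;
      \<And>i. i < n \<Longrightarrow> a \<le> L $$ (i, i) \<and> a \<le> M $$ (i, i);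
      \<And>i j. i < n \<Longrightarrow> j < n \<Longrightarrow> \<bar>L $$ (i, j)\<bar> \<le> b \<and> \<bar>M $$ (i, j)\<bar> \<le> b;
      \<And>i j. i < n \<Longrightarrow> j < n \<Longrightarrow>
        \<bar>(L * transpose_mat L - M * transpose_mat M) $$ (i, j)\<bar> \<le> \<epsilon>;
      i < n; j < n\<rbrakk> \<Longrightarrow> \<bar>(L - M) $$ (i, j)\<bar> \<le> C * \<epsilon>"
proof (rule cholesky_perturbation_fun[OF assms, where n = n])
  fix C assume C: "0 \<le> C"
    and *: "\<And>l m \<epsilon> i j. \<lbrakk>0 \<le> \<epsilon>; \<And>i j. i < n \<Longrightarrow> j < n \<Longrightarrow> i < j \<Longrightarrow> l i j = 0 \<and> m i j = 0;
      \<And>i. i < n \<Longrightarrow> a \<le> l i i \<and> a \<le> m i i;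
      \<And>i j. i < n \<Longrightarrow> j < n \<Longrightarrow> \<bar>l i j\<bar> \<le> b \<and> \<bar>m i j\<bar> \<le> b;
      \<And>i j. i < n \<Longrightarrow> j < n \<Longrightarrow>
        \<bar>(\<Sum>k<n. l i k * l j k) - (\<Sum>k<n. m i k * m j k)\<bar> \<le> \<epsilon>;
      i < n; j < n\<rbrakk> \<Longrightarrow> \<bar>l i j - m i j\<bar> \<le> C * \<epsilon>"
  show thesis
  proof (rule that[OF C])
    fix L M :: "real mat" and \<epsilon> :: real and i j
    assume L: "L \<in> lower_pos n" and M: "M \<in> lower_pos n" and e: "0 \<le> \<epsilon>"
      and ab: "\<And>i. i < n \<Longrightarrow> a \<le> L $$ (i, i) \<and> a \<le> M $$ (i, i)"
        "\<And>i j. i < n \<Longrightarrow> j < n \<Longrightarrow> \<bar>L $$ (i, j)\<bar> \<le> b \<and> \<bar>M $$ (i, j)\<bar> \<le> b"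
      and d: "\<And>i j. i < n \<Longrightarrow> j < n \<Longrightarrow>
        \<bar>(L * transpose_mat L - M * transpose_mat M) $$ (i, j)\<bar> \<le> \<epsilon>"
      and ij: "i < n" "j < n"
    note Lc = lower_posD[OF L] and Mc = lower_posD[OF M]
    have "(L * transpose_mat L - M * transpose_mat M) $$ (i, j)
      = (\<Sum>k<n. L $$ (i, k) * L $$ (j, k)) - (\<Sum>k<n. M $$ (i, k) * M $$ (j, k))"
      if "i < n" "j < n" for i j
      using that Lc(1) Mc(1) by (simp add: scalar_prod_def atLeast0LessThan)
    with d have "\<bar>L $$ (i, j) - M $$ (i, j)\<bar> \<le> C * \<epsilon>"
      using Lc Mc ab ij e
      by (intro *[of \<epsilon> "\<lambda>i j. L $$ (i, j)" "\<lambda>i j. M $$ (i, j)"]) auto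
    then show "\<bar>(L - M) $$ (i, j)\<bar> \<le> C * \<epsilon>" using ij Lc Mc by auto
  qed
qed

text \<open>The perturbation bound at \<epsilon> = 0. Two given factors have finitely many entries,
  so admissible bounds \<open>a\<close> and \<open>b\<close> can be read off from them.\<close>

lemma lower_pos_cholesky_unique:
  assumes L: "L \<in> lower_pos n" and M: "M \<in> lower_pos n"
    and eq: "L * transpose_mat L = M * transpose_mat M"
  shows "L = M"
proof -
  note Lc = lower_posD[OF L] and Mc = lower_posD[OF M]
  \<comment> \<open>The inserted 1 and 0 keep both sets nonempty when \<open>n = 0\<close>; they
    preserve positivity of the minimum and make the maximum nonnegative.\<close>
  let ?A = "insert 1 ((\<lambda>i. L $$ (i, i)) ` {..<n} \<union> (\<lambda>i. M $$ (i, i)) ` {..<n})"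
  let ?B = "insert 0 ((\<lambda>p. \<bar>L $$ p\<bar>) ` ({..<n} \<times> {..<n}) \<union> (\<lambda>p. \<bar>M $$ p\<bar>) ` ({..<n} \<times> {..<n}))"
  have "0 < Min ?A" "0 \<le> Max ?B" using Lc Mc by (auto intro!: Max_ge)
  then obtain C where C: "\<And>L M \<epsilon> i j. \<lbrakk>L \<in> lower_pos n; M \<in> lower_pos n; 0 \<le> \<epsilon>;
      \<And>i. i < n \<Longrightarrow> Min ?A \<le> L $$ (i, i) \<and> Min ?A \<le> M $$ (i, i);
      \<And>i j. i < n \<Longrightarrow> j < n \<Longrightarrow> \<bar>L $$ (i, j)\<bar> \<le> Max ?B \<and> \<bar>M $$ (i, j)\<bar> \<le> Max ?B;
      \<And>i j. i < n \<Longrightarrow> j < n \<Longrightarrow>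
        \<bar>(L * transpose_mat L - M * transpose_mat M) $$ (i, j)\<bar> \<le> \<epsilon>;
      i < n; j < n\<rbrakk> \<Longrightarrow> \<bar>(L - M) $$ (i, j)\<bar> \<le> C * \<epsilon>"
    by (rule cholesky_perturbation[where n = n]) blast
  have "\<bar>(L - M) $$ (i, j)\<bar> \<le> C * 0" if "i < n" "j < n" for i j
  proof (rule C[OF L M])
    show "Min ?A \<le> L $$ (i, i) \<and> Min ?A \<le> M $$ (i, i)" if "i < n" for i
      using that by (intro conjI Min_le) auto
    show "\<bar>L $$ (i, j)\<bar> \<le> Max ?B \<and> \<bar>M $$ (i, j)\<bar> \<le> Max ?B" if "i < n" "j < n" for i j
      using that by (intro conjI Max_ge) auto
    show "\<bar>(L * transpose_mat L - M * transpose_mat M) $$ (i, j)\<bar> \<le> 0" if "i < n" "j < n" for i j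
      using that eq Mc(1) by simp
  qed (use that in auto)
  then show ?thesis using Lc(1) Mc(1) by (intro eq_matI) auto
qed

lemma cholesky_mult_transpose:
  assumes "L \<in> lower_pos n"
  shows "cholesky (L * transpose_mat L) = L"
  unfolding cholesky_def
proof (rule the_equality)
  have c: "L * transpose_mat L \<in> carrier_mat n n" using lower_posD(1)[OF assms] by simp
  show "is_cholesky_factor (L * transpose_mat L) L" using assms by (simp add: is_cholesky_factor_iff[OF c])
  show "M = L" if "is_cholesky_factor (L * transpose_mat L) M" for M
    using that lower_pos_cholesky_unique[OF _ assms] by (simp add: is_cholesky_factor_iff[OF c])
qed

lemma cholesky_spd:
  assumes "X \<in> spd n"
  shows "cholesky X \<in> lower_pos n" "cholesky X * transpose_mat (cholesky X) = X"
  using assms by (metis spd_cholesky_exists cholesky_mult_transpose)+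

section \<open>Log-Cholesky coordinates and the mean\<close>

text \<open>Coordinates are addressed by matrix position. The order chosen in
  \<open>log_cholesky\<close> then matters only where \<open>lc_index_list\<close> enumerates the
  positions.\<close>

definition lc_coord :: "real mat \<Rightarrow> nat \<times> nat \<Rightarrow> real" where
  "lc_coord X p = (if fst p = snd p then ln (cholesky X $$ p) else cholesky X $$ p)"

definition lc_index_list :: "nat \<Rightarrow> (nat \<times> nat) list" where
  "lc_index_list n = [(i, j). i \<leftarrow> [0..<n], j \<leftarrow> [0..<i]] @ [(i, i). i \<leftarrow> [0..<n]]"

definition lc_index :: "nat \<Rightarrow> (nat \<times> nat) set" where
  "lc_index n = {(i, j). j \<le> i \<and> i < n}"

lemma finite_lc_index [simp]: "finite (lc_index n)"
  by (rule finite_subset[of _ "{..<n} \<times> {..<n}"]) (auto simp: lc_index_def)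

lemma set_lc_index_list: "set (lc_index_list n) = lc_index n"
  by (fastforce simp: lc_index_list_def lc_index_def image_iff)

lemma length_lc_index_list: "length (lc_index_list n) = n * (n + 1) div 2"
proof -
  have "2 * length [(i, j). i \<leftarrow> [0..<n], j \<leftarrow> [0..<i]] + n = n * n"
    by (induction n) auto
  then show ?thesis by (simp add: lc_index_list_def)
qed

lemma distinct_lc_index_list: "distinct (lc_index_list n)"
proof -
  have "distinct [(i, j). i \<leftarrow> [0..<n], j \<leftarrow> [0..<i]]"
    by (induction n) (auto simp: distinct_map inj_on_def)
  then show ?thesis by (auto simp: lc_index_list_def distinct_map inj_on_def)
qed

lemma log_cholesky_eq:
  "X \<in> carrier_mat n n \<Longrightarrow> log_cholesky X = vec_of_list (map (lc_coord X) (lc_index_list n))"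
  unfolding log_cholesky_def lc_index_list_def
  by (auto simp: lc_coord_def map_concat comp_def intro!: arg_cong[of _ _ vec_of_list]
      arg_cong[of _ _ concat])

lemma dist_LC_eq:
  assumes "X \<in> carrier_mat n n" "Z \<in> carrier_mat n n"
  shows "dist_LC X Z = L2_set (\<lambda>p. lc_coord X p - lc_coord Z p) (lc_index n)"
proof -
  let ?l = "lc_index_list n"
  have "(\<Sum>k<length ?l. (lc_coord X (?l ! k) - lc_coord Z (?l ! k))\<^sup>2)
    = (\<Sum>p\<in>lc_index n. (lc_coord X p - lc_coord Z p)\<^sup>2)"
    using bij_betw_nth[OF distinct_lc_index_list refl set_lc_index_list[symmetric], of n]
    by (rule sum.reindex_bij_betw)
  then show ?thesis
    by (simp add: dist_LC_def euclidean_norm_def L2_set_def log_cholesky_eq[OF assms(1)]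
        log_cholesky_eq[OF assms(2)] scalar_prod_def atLeast0LessThan power2_eq_square
        vec_of_list_index del: vec_of_list_map)
qed

lemma lc_coord_inject:
  assumes X: "X \<in> spd n" and Z: "Z \<in> spd n"
    and eq: "\<And>p. p \<in> lc_index n \<Longrightarrow> lc_coord X p = lc_coord Z p"
  shows "X = Z"
proof -
  note L = lower_posD[OF cholesky_spd(1)[OF X]] and M = lower_posD[OF cholesky_spd(1)[OF Z]]
  have "cholesky X = cholesky Z"
  proof (rule eq_matI)
    fix i j assume "i < dim_row (cholesky Z)" "j < dim_col (cholesky Z)"
    then have ij: "i < n" "j < n" using M by auto
    consider "i < j" | "i = j" | "j < i" by linarith
    then show "cholesky X $$ (i, j) = cholesky Z $$ (i, j)"
    proof cases
      case 2
      then show ?thesis using eq[of "(i, i)"] L(3)[of i] M(3)[of i] ij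
        by (auto simp: lc_coord_def lc_index_def)
    qed (use ij eq[of "(i, j)"] L(2) M(2) in \<open>auto simp: lc_coord_def lc_index_def\<close>)
  qed (use L M in auto)
  then show ?thesis using cholesky_spd(2)[OF X] cholesky_spd(2)[OF Z] by metis
qed

text \<open>Exponentiating the prescribed diagonal always gives an admissible factor. Hence the
  vector of coordinate means is attained in \<open>spd n\<close>.\<close>

lemma lc_coord_surj:
  obtains M where "M \<in> spd n" "\<And>p. p \<in> lc_index n \<Longrightarrow> lc_coord M p = \<mu> p"
proof -
  define L where "L = mat n n (\<lambda>(i, j). if i = j then exp (\<mu> (i, j)) else if j < i then \<mu> (i, j) else 0)"
  have L: "L \<in> lower_pos n" by (auto simp: L_def lower_pos_def)
  show thesis
    using cholesky_mult_transpose[OF L]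
    by (intro that[OF lower_pos_mult_transpose_spd[OF L]])
      (auto simp: lc_coord_def lc_index_def, auto simp: L_def)
qed

lemma log_cholesky_inv_log_cholesky:
  assumes "X \<in> spd n"
  shows "log_cholesky_inv n (log_cholesky X) = X"
  unfolding log_cholesky_inv_def
proof (rule inv_into_f_f[OF inj_onI assms])
  fix X Z assume XZ: "X \<in> spd n" "Z \<in> spd n" and eq: "log_cholesky X = log_cholesky Z"
  have "map (lc_coord X) (lc_index_list n) = map (lc_coord Z) (lc_index_list n)"
    using eq log_cholesky_eq[OF spdD(1)[OF XZ(1)]] log_cholesky_eq[OF spdD(1)[OF XZ(2)]]
    by (metis list_vec)
  then show "X = Z" using XZ by (intro lc_coord_inject) (auto simp flip: set_lc_index_list)
qed

text \<open>Expanding each coordinate of the objective around the mean \<mu> cancels the linear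
  term. What remains is the value at \<mu> plus \<open>real H\<close> times the squared distance to
  \<mu>, so the minimizer exists, is unique and has coordinates \<mu>.\<close>

lemma frechet_mean_LC_coord:
  assumes H: "1 \<le> H" and Xs: "\<And>h. h < H \<Longrightarrow> Xs h \<in> spd n"
  shows "frechet_mean_LC n H Xs \<in> spd n"
    and "\<And>p. p \<in> lc_index n \<Longrightarrow>
      lc_coord (frechet_mean_LC n H Xs) p = (\<Sum>h<H. lc_coord (Xs h) p) / real H"
proof -
  define \<mu> where "\<mu> p = (\<Sum>h<H. lc_coord (Xs h) p) / real H" for p
  obtain M where M: "M \<in> spd n" and M\<mu>: "\<And>p. p \<in> lc_index n \<Longrightarrow> lc_coord M p = \<mu> p"
    using lc_coord_surj[of n \<mu>] by blast
  define f where "f X = (\<Sum>h<H. (dist_LC X (Xs h))\<^sup>2)" for X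
  have f: "f X = f M + real H * (\<Sum>p\<in>lc_index n. (lc_coord X p - \<mu> p)\<^sup>2)" if X: "X \<in> spd n" for X
  proof -
    have g: "f X = (\<Sum>p\<in>lc_index n. \<Sum>h<H. (lc_coord X p - lc_coord (Xs h) p)\<^sup>2)"
      if X: "X \<in> spd n" for X
      unfolding f_def using Xs X
      by (subst sum.swap) (simp add: dist_LC_eq[of _ n] spdD(1) L2_set_def sum_nonneg)
    have sq: "(\<Sum>h<H. (x - lc_coord (Xs h) p)\<^sup>2)
      = (\<Sum>h<H. (\<mu> p - lc_coord (Xs h) p)\<^sup>2) + real H * (x - \<mu> p)\<^sup>2" for x p
    proof -
      have s: "(\<Sum>h<H. lc_coord (Xs h) p) = real H * \<mu> p" using H by (simp add: \<mu>_def)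
      have e: "(\<Sum>h<H. (y - lc_coord (Xs h) p)\<^sup>2)
        = real H * y\<^sup>2 - 2 * y * (real H * \<mu> p) + (\<Sum>h<H. (lc_coord (Xs h) p)\<^sup>2)" for y
        by (simp add: power2_diff sum.distrib sum_subtractf flip: s sum_distrib_left)
      show ?thesis unfolding e by (simp add: power2_eq_square algebra_simps)
    qed
    have "f X = (\<Sum>p\<in>lc_index n. (\<Sum>h<H. (\<mu> p - lc_coord (Xs h) p)\<^sup>2)
        + real H * (lc_coord X p - \<mu> p)\<^sup>2)"
      unfolding g[OF X] by (intro sum.cong refl sq)
    then show ?thesis by (simp add: g[OF M] sum.distrib sum_distrib_left M\<mu>)
  qed
  have "frechet_mean_LC n H Xs = M"
    unfolding frechet_mean_LC_def f_def[symmetric]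
  proof (rule the_equality)
    show "is_arg_min f (\<lambda>X. X \<in> spd n) M"
    proof -
      have "f M \<le> f Z" if "Z \<in> spd n" for Z
        using f[OF that] by (simp add: sum_nonneg)
      then show ?thesis using M by (auto simp: is_arg_min_def not_less)
    qed
    fix X assume "is_arg_min f (\<lambda>X. X \<in> spd n) X"
    then have X: "X \<in> spd n" and "f X \<le> f M" using M by (auto simp: is_arg_min_def not_less)
    then have "real H * (\<Sum>p\<in>lc_index n. (lc_coord X p - \<mu> p)\<^sup>2) \<le> 0" using f[OF X] by simp
    then have "(\<Sum>p\<in>lc_index n. (lc_coord X p - \<mu> p)\<^sup>2) \<le> 0" using H by (simp add: mult_le_0_iff)
    then have "(\<Sum>p\<in>lc_index n. (lc_coord X p - \<mu> p)\<^sup>2) = 0" by (simp add: order_antisym sum_nonneg)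
    then have "\<forall>p\<in>lc_index n. lc_coord X p = \<mu> p" by (simp add: sum_nonneg_eq_0_iff)
    then show "X = M" using X M M\<mu> by (intro lc_coord_inject) auto
  qed
  then show "frechet_mean_LC n H Xs \<in> spd n"
    "\<And>p. p \<in> lc_index n \<Longrightarrow>
      lc_coord (frechet_mean_LC n H Xs) p = (\<Sum>h<H. lc_coord (Xs h) p) / real H"
    using M M\<mu> by (auto simp: \<mu>_def)
qed

lemma frechet_mean_LC_eq_inv:
  assumes H: "1 \<le> H" and Xs: "\<And>h. h < H \<Longrightarrow> Xs h \<in> spd n"
  shows "frechet_mean_LC n H Xs = log_cholesky_inv n ((1 / real H) \<cdot>\<^sub>v
    finsum_vec TYPE(real) (n * (n + 1) div 2) (\<lambda>h. log_cholesky (Xs h)) {..<H})"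
proof -
  let ?M = "frechet_mean_LC n H Xs" and ?N = "n * (n + 1) div 2"
  let ?s = "finsum_vec TYPE(real) ?N (\<lambda>h. log_cholesky (Xs h)) {..<H}"
  have M: "?M \<in> spd n"
    "\<And>p. p \<in> lc_index n \<Longrightarrow> lc_coord ?M p = (\<Sum>h<H. lc_coord (Xs h) p) / real H"
    using frechet_mean_LC_coord[of H Xs n] assms by auto
  have lc: "log_cholesky X \<in> carrier_vec ?N \<and>
      (\<forall>k<?N. log_cholesky X $ k = lc_coord X (lc_index_list n ! k))"
    if "X \<in> spd n" for X
    using spdD(1)[OF that] unfolding log_cholesky_eq[OF spdD(1)[OF that]] carrier_vec_def
    by (simp add: length_lc_index_list vec_of_list_index del: vec_of_list_map)
  have s: "?s \<in> carrier_vec ?N" using lc Xs by (intro finsum_vec_closed) auto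
  have "log_cholesky ?M = (1 / real H) \<cdot>\<^sub>v ?s"
  proof (rule eq_vecI)
    fix k assume "k < dim_vec ((1 / real H) \<cdot>\<^sub>v ?s)"
    then have k: "k < ?N" using s by simp
    then have "lc_index_list n ! k \<in> lc_index n"
      by (metis length_lc_index_list nth_mem set_lc_index_list)
    moreover have "?s $ k = (\<Sum>h<H. log_cholesky (Xs h) $ k)"
      using k lc Xs by (intro index_finsum_vec) auto
    ultimately show "log_cholesky ?M $ k = ((1 / real H) \<cdot>\<^sub>v ?s) $ k"
      using k s lc[OF M(1)] lc[OF Xs] by (simp add: M(2))
  qed (use s lc M in auto)
  then show ?thesis using log_cholesky_inv_log_cholesky[of ?M n] M(1) by metis
qed

section \<open>Operator and Frobenius bounds\<close>

lemma scalar_prod_Cauchy_Schwarz: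
  fixes v w :: "real vec"
  assumes "v \<in> carrier_vec n" "w \<in> carrier_vec n"
  shows "(v \<bullet> w)\<^sup>2 \<le> (v \<bullet> v) * (w \<bullet> w)"
proof -
  have s: "v \<bullet> w = (\<Sum>i<n. v $ i * w $ i)" "v \<bullet> v = (L2_set (($) v) {..<n})\<^sup>2"
    "w \<bullet> w = (L2_set (($) w) {..<n})\<^sup>2"
    using assms by (auto simp: scalar_prod_def atLeast0LessThan L2_set_def power2_eq_square
        sum_nonneg simp flip: real_sqrt_mult)
  have "\<bar>v \<bullet> w\<bar> \<le> (\<Sum>i<n. \<bar>v $ i\<bar> * \<bar>w $ i\<bar>)"
    unfolding s(1) by (rule order_trans[OF sum_abs]) (simp add: abs_mult)
  also have "\<dots> \<le> L2_set (($) v) {..<n} * L2_set (($) w) {..<n}" by (rule L2_set_mult_ineq)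
  finally show ?thesis
    unfolding s(2,3) power_mult_distrib[symmetric] by (metis abs_ge_zero power2_abs power_mono)
qed

lemma component_sq_le_scalar_prod:
  fixes v :: "real vec"
  assumes "i < dim_vec v"
  shows "(v $ i)\<^sup>2 \<le> v \<bullet> v"
  using assms member_le_sum[of i "{0..<dim_vec v}" "\<lambda>i. v $ i * v $ i"]
  by (simp add: scalar_prod_def power2_eq_square)

text \<open>A matrix and its transpose have the same operator norm; here and below \<open>c\<close>
  bounds its square. With \<open>?w\<close> the image of \<open>v\<close>, Cauchy-Schwarz applied to
  \<open>?w \<bullet> ?w = v \<bullet> (A *\<^sub>v ?w)\<close> gives the bound after cancelling one
  factor \<open>?w \<bullet> ?w\<close>.\<close>

lemma mult_transpose_vec_sq_le:
  fixes A :: "real mat"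
  assumes A: "A \<in> carrier_mat n k" and c: "0 \<le> c"
    and bd: "\<And>v. v \<in> carrier_vec k \<Longrightarrow> (A *\<^sub>v v) \<bullet> (A *\<^sub>v v) \<le> c * (v \<bullet> v)"
    and v: "v \<in> carrier_vec n"
  shows "(transpose_mat A *\<^sub>v v) \<bullet> (transpose_mat A *\<^sub>v v) \<le> c * (v \<bullet> v)"
proof -
  let ?w = "transpose_mat A *\<^sub>v v"
  have w: "?w \<in> carrier_vec k" using A v by auto
  have "?w \<bullet> ?w = v \<bullet> (A *\<^sub>v ?w)" by (rule transpose_vec_mult_scalar[OF A w v])
  then have "(?w \<bullet> ?w)\<^sup>2 = (v \<bullet> (A *\<^sub>v ?w))\<^sup>2" by simp
  also have "\<dots> \<le> (v \<bullet> v) * ((A *\<^sub>v ?w) \<bullet> (A *\<^sub>v ?w))"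
    using A w v by (intro scalar_prod_Cauchy_Schwarz) auto
  also have "\<dots> \<le> (v \<bullet> v) * (c * (?w \<bullet> ?w))"
    by (intro mult_left_mono bd w scalar_prod_self_nonneg)
  finally have le: "(?w \<bullet> ?w) * (?w \<bullet> ?w) \<le> (c * (v \<bullet> v)) * (?w \<bullet> ?w)"
    by (simp add: power2_eq_square mult_ac)
  show ?thesis
  proof (cases "?w \<bullet> ?w = 0")
    case True
    then show ?thesis using c scalar_prod_self_nonneg[of v] by simp
  next
    case False
    then have "0 < ?w \<bullet> ?w" using scalar_prod_self_nonneg[of ?w] by simp
    then show ?thesis using le by simp
  qed
qed

definition frob :: "real mat \<Rightarrow> real" where
  "frob A = L2_set (($$) A) ({..<dim_row A} \<times> {..<dim_col A})"

lemma frob_nonneg [simp]: "0 \<le> frob A"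
  by (simp add: frob_def)

lemma frob_sq: "A \<in> carrier_mat n m \<Longrightarrow> (frob A)\<^sup>2 = (\<Sum>p\<in>{..<n} \<times> {..<m}. (A $$ p)\<^sup>2)"
  by (auto simp: frob_def L2_set_def sum_nonneg)

lemma frob_sq_sum:
  "A \<in> carrier_mat n m \<Longrightarrow> (frob A)\<^sup>2 = (\<Sum>i<n. \<Sum>j<m. (A $$ (i, j))\<^sup>2)"
  unfolding frob_sq sum.cartesian_product by (simp add: case_prod_unfold)

lemma frob_sq_cols: "A \<in> carrier_mat n m \<Longrightarrow> (frob A)\<^sup>2 = (\<Sum>j<m. col A j \<bullet> col A j)"
  unfolding frob_sq_sum
  by (subst sum.swap) (auto simp: scalar_prod_def power2_eq_square atLeast0LessThan intro!: sum.cong)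

lemma abs_entry_le_frob:
  assumes "A \<in> carrier_mat n m" "i < n" "j < m"
  shows "\<bar>A $$ (i, j)\<bar> \<le> frob A"
proof -
  have "(A $$ (i, j))\<^sup>2 \<le> (frob A)\<^sup>2"
    unfolding frob_sq[OF assms(1)] using assms by (intro member_le_sum) auto
  then show ?thesis by (rule abs_le_square_iff[THEN iffD2, THEN order_trans]) simp
qed

lemma frob_le:
  assumes "A \<in> carrier_mat n n" "\<And>i j. i < n \<Longrightarrow> j < n \<Longrightarrow> \<bar>A $$ (i, j)\<bar> \<le> c" "0 \<le> c"
  shows "frob A \<le> real n * c"
proof -
  have "(frob A)\<^sup>2 \<le> (\<Sum>p\<in>{..<n} \<times> {..<n}. c\<^sup>2)"
    unfolding frob_sq[OF assms(1)]
  proof (rule sum_mono)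
    fix p assume "p \<in> {..<n} \<times> {..<n}"
    then have "\<bar>A $$ p\<bar> \<le> c" using assms(2) by auto
    then show "(A $$ p)\<^sup>2 \<le> c\<^sup>2" using assms(3) by (simp add: abs_le_square_iff[symmetric])
  qed
  also have "\<dots> = (real n * c)\<^sup>2" by (simp add: power2_eq_square)
  finally show ?thesis by (rule power2_le_imp_le) (use assms(3) in simp)
qed

lemma frob_transpose: "frob (transpose_mat A) = frob A"
proof -
  have "(frob (transpose_mat A))\<^sup>2 = (frob A)\<^sup>2"
    unfolding frob_sq_sum[OF carrier_matI[OF refl refl]]
    by (subst sum.swap) (auto intro!: sum.cong)
  then show ?thesis by simp
qed

lemma frob_add_le:
  assumes "A \<in> carrier_mat n m" "B \<in> carrier_mat n m"
  shows "frob (A + B) \<le> frob A + frob B"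
proof -
  have "frob (A + B) = L2_set (\<lambda>p. A $$ p + B $$ p) ({..<n} \<times> {..<m})"
    unfolding frob_def using assms by (intro L2_set_cong) auto
  also have "\<dots> \<le> frob A + frob B"
    unfolding frob_def using assms L2_set_triangle_ineq by auto
  finally show ?thesis .
qed

lemma frob_smult: "frob (c \<cdot>\<^sub>m A) = \<bar>c\<bar> * frob A"
proof -
  have "frob (c \<cdot>\<^sub>m A) = L2_set (\<lambda>p. c * A $$ p) ({..<dim_row A} \<times> {..<dim_col A})"
    unfolding frob_def by (intro L2_set_cong) auto
  then show ?thesis
    by (simp add: frob_def L2_set_def power_mult_distrib real_sqrt_mult flip: sum_distrib_left)
qed

text \<open>The squared Frobenius norm is the sum over the columns, and \<open>A\<close> acts on
  each column separately.\<close>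

lemma frob_mult_le:
  assumes A: "A \<in> carrier_mat n k" and B: "B \<in> carrier_mat k m" and c: "0 \<le> c"
    and bd: "\<And>v. v \<in> carrier_vec k \<Longrightarrow> (A *\<^sub>v v) \<bullet> (A *\<^sub>v v) \<le> c * (v \<bullet> v)"
  shows "frob (A * B) \<le> sqrt c * frob B"
proof -
  have "(frob (A * B))\<^sup>2 = (\<Sum>j<m. (A *\<^sub>v col B j) \<bullet> (A *\<^sub>v col B j))"
    unfolding frob_sq_cols[OF mult_carrier_mat[OF A B]] using col_mult2[OF A B] by simp
  also have "\<dots> \<le> (\<Sum>j<m. c * (col B j \<bullet> col B j))"
    using B by (intro sum_mono bd) auto
  also have "\<dots> = (sqrt c * frob B)\<^sup>2"
    using c by (simp add: power_mult_distrib frob_sq_cols[OF B] sum_distrib_left)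
  finally show ?thesis by (rule power2_le_imp_le) (use c in simp)
qed

lemma frob_mult_transpose_le:
  assumes A: "A \<in> carrier_mat n k" and B: "B \<in> carrier_mat m k" and c: "0 \<le> c"
    and bd: "\<And>v. v \<in> carrier_vec k \<Longrightarrow> (A *\<^sub>v v) \<bullet> (A *\<^sub>v v) \<le> c * (v \<bullet> v)"
  shows "frob (B * transpose_mat A) \<le> sqrt c * frob B"
proof -
  have "frob (B * transpose_mat A) = frob (A * transpose_mat B)"
    using A B transpose_mult[of B m k "transpose_mat A" n]
    by (subst frob_transpose[symmetric]) auto
  also have "\<dots> \<le> sqrt c * frob (transpose_mat B)"
    using A B c bd by (intro frob_mult_le) auto
  finally show ?thesis by (simp add: frob_transpose)
qed

lemma mult_mat_vec_sq_le_frob: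
  assumes A: "A \<in> carrier_mat n k" and v: "v \<in> carrier_vec k"
  shows "(A *\<^sub>v v) \<bullet> (A *\<^sub>v v) \<le> (frob A)\<^sup>2 * (v \<bullet> v)"
proof -
  have "(A *\<^sub>v v) \<bullet> (A *\<^sub>v v) = (\<Sum>i<n. (row A i \<bullet> v)\<^sup>2)"
    using A by (auto simp: scalar_prod_def[of "A *\<^sub>v v"] power2_eq_square atLeast0LessThan)
  also have "\<dots> \<le> (\<Sum>i<n. (row A i \<bullet> row A i) * (v \<bullet> v))"
    using A v by (intro sum_mono scalar_prod_Cauchy_Schwarz) auto
  also have "\<dots> = (frob (transpose_mat A))\<^sup>2 * (v \<bullet> v)"
    using A by (simp add: frob_sq_cols[of _ k n] sum_distrib_right)
  finally show ?thesis by (simp add: frob_transpose)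
qed

section \<open>Cholesky factors of matrices in a spectral band\<close>

lemma spectral_band_iff:
  "X \<in> spectral_band n \<alpha> \<beta> \<longleftrightarrow> X \<in> spd n \<and>
    (\<forall>v\<in>carrier_vec n. \<alpha> * (v \<bullet> v) \<le> v \<bullet> (X *\<^sub>v v) \<and> v \<bullet> (X *\<^sub>v v) \<le> \<beta> * (v \<bullet> v))"
proof -
  have "loewner_le n (\<alpha> \<cdot>\<^sub>m 1\<^sub>m n) X \<longleftrightarrow> (\<forall>v\<in>carrier_vec n. \<alpha> * (v \<bullet> v) \<le> v \<bullet> (X *\<^sub>v v))"
    "loewner_le n X (\<beta> \<cdot>\<^sub>m 1\<^sub>m n) \<longleftrightarrow> (\<forall>v\<in>carrier_vec n. v \<bullet> (X *\<^sub>v v) \<le> \<beta> * (v \<bullet> v))"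
    if X: "X \<in> spd n"
  proof -
    note Xc = spdD(1,2)[OF X]
    have sym: "X $$ (j, i) = X $$ (i, j)" if "i < n" "j < n" for i j
      using that Xc by (metis carrier_matD index_transpose_mat(1))
    have sm: "(c \<cdot>\<^sub>m 1\<^sub>m n) *\<^sub>v v = c \<cdot>\<^sub>v v" if "v \<in> carrier_vec n" for c :: real and v
      using that by (intro eq_vecI) auto
    have "v \<bullet> ((X - c \<cdot>\<^sub>m 1\<^sub>m n) *\<^sub>v v) = v \<bullet> (X *\<^sub>v v) - c * (v \<bullet> v)"
      "v \<bullet> ((c \<cdot>\<^sub>m 1\<^sub>m n - X) *\<^sub>v v) = c * (v \<bullet> v) - v \<bullet> (X *\<^sub>v v)"
      if v: "v \<in> carrier_vec n" for v c
      using v Xc by (simp_all add: minus_mult_distrib_mat_vec[of _ n n] sm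
          scalar_prod_minus_distrib[of _ n])
    moreover have "transpose_mat (X - c \<cdot>\<^sub>m 1\<^sub>m n) = X - c \<cdot>\<^sub>m 1\<^sub>m n"
      "transpose_mat (c \<cdot>\<^sub>m 1\<^sub>m n - X) = c \<cdot>\<^sub>m 1\<^sub>m n - X" for c
      using Xc(1) sym by (auto intro!: eq_matI)
    ultimately show "loewner_le n (\<alpha> \<cdot>\<^sub>m 1\<^sub>m n) X \<longleftrightarrow> (\<forall>v\<in>carrier_vec n. \<alpha> * (v \<bullet> v) \<le> v \<bullet> (X *\<^sub>v v))"
      "loewner_le n X (\<beta> \<cdot>\<^sub>m 1\<^sub>m n) \<longleftrightarrow> (\<forall>v\<in>carrier_vec n. v \<bullet> (X *\<^sub>v v) \<le> \<beta> * (v \<bullet> v))"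
      using Xc by (auto simp: loewner_le_def)
  qed
  then show ?thesis by (auto simp: spectral_band_def)
qed

text \<open>Forward substitution: in entry \<open>(i, j)\<close> of \<open>L * N = 1\<close> the
  terms \<open>k < i\<close> vanish by induction and the terms \<open>k > i\<close> by triangularity
  of \<open>L\<close>, leaving \<open>L $$ (i, i) * N $$ (i, j) = 0\<close>.\<close>

lemma lower_triangular_inverse:
  assumes L: "L \<in> lower_pos n" and N: "N \<in> carrier_mat n n" "L * N = 1\<^sub>m n"
    and ij: "i < j" "j < n"
  shows "N $$ (i, j) = 0"
  using ij(1)
proof (induction i rule: less_induct)
  case (less i)
  note Lc = lower_posD[OF L]
  have "0 = (L * N) $$ (i, j)" using N ij(2) less.prems by simp
  also have "\<dots> = (\<Sum>k<n. L $$ (i, k) * N $$ (k, j))"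
    using mult_index[OF Lc(1) N(1)] ij(2) less.prems by simp
  also have "\<dots> = (\<Sum>k\<in>{i}. L $$ (i, k) * N $$ (k, j))"
  proof (rule sum.mono_neutral_right)
    show "\<forall>k\<in>{..<n} - {i}. L $$ (i, k) * N $$ (k, j) = 0"
    proof
      fix k assume "k \<in> {..<n} - {i}"
      then consider "k < i" | "i < k" "k < n" by fastforce
      then show "L $$ (i, k) * N $$ (k, j) = 0"
        using less Lc by cases auto
    qed
  qed (use ij(2) less.prems in auto)
  finally show ?case using Lc(3)[of i] ij(2) less.prems by auto
qed

lemma lower_triangular_mult:
  fixes A B :: "real mat"
  assumes "A \<in> carrier_mat n n" "B \<in> carrier_mat n n"
    and "\<And>i j. i < j \<Longrightarrow> j < n \<Longrightarrow> A $$ (i, j) = 0" "\<And>i j. i < j \<Longrightarrow> j < n \<Longrightarrow> B $$ (i, j) = 0"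
  shows "i < j \<Longrightarrow> j < n \<Longrightarrow> (A * B) $$ (i, j) = 0"
    and "i < n \<Longrightarrow> (A * B) $$ (i, i) = A $$ (i, i) * B $$ (i, i)"
proof -
  have z: "A $$ (i, k) * B $$ (k, j) = 0" if "k < n" "j < n" "i < n" "i < k \<or> k < j" for i j k
    using that assms by auto
  show "(A * B) $$ (i, j) = 0" if "i < j" "j < n"
    using that z[of _ j i] mult_index[OF assms(1,2), of i j]
    by (auto intro!: sum.neutral) (metis linorder_not_less order_less_le_trans)
  show "(A * B) $$ (i, i) = A $$ (i, i) * B $$ (i, i)" if "i < n"
  proof -
    have "(A * B) $$ (i, i) = (\<Sum>k\<in>{i}. A $$ (i, k) * B $$ (k, i))"
      unfolding mult_index[OF assms(1,2) that that]
    proof (rule sum.mono_neutral_right)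
      show "\<forall>k\<in>{..<n} - {i}. A $$ (i, k) * B $$ (k, i) = 0"
      proof
        fix k assume "k \<in> {..<n} - {i}"
        then show "A $$ (i, k) * B $$ (k, i) = 0" using that by (intro z) auto
      qed
    qed (use that in auto)
    then show ?thesis by simp
  qed
qed

lemma spectral_band_cholesky:
  assumes Y: "Y \<in> spectral_band n \<alpha> \<beta>" and v: "v \<in> carrier_vec n"
  shows "(transpose_mat (cholesky Y) *\<^sub>v v) \<bullet> (transpose_mat (cholesky Y) *\<^sub>v v) \<le> \<beta> * (v \<bullet> v)"
    and "\<alpha> * (v \<bullet> v) \<le> (transpose_mat (cholesky Y) *\<^sub>v v) \<bullet> (transpose_mat (cholesky Y) *\<^sub>v v)"
proof -
  have "Y \<in> spd n" using Y by (simp add: spectral_band_iff)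
  note L = cholesky_spd[OF this]
  show "(transpose_mat (cholesky Y) *\<^sub>v v) \<bullet> (transpose_mat (cholesky Y) *\<^sub>v v) \<le> \<beta> * (v \<bullet> v)"
    "\<alpha> * (v \<bullet> v) \<le> (transpose_mat (cholesky Y) *\<^sub>v v) \<bullet> (transpose_mat (cholesky Y) *\<^sub>v v)"
    using Y v gram_quadratic_form[OF lower_posD(1)[OF L(1)] v] by (auto simp: spectral_band_iff L(2))
qed

lemma spectral_band_cholesky_mult_vec:
  assumes Y: "Y \<in> spectral_band n \<alpha> \<beta>" and b: "0 \<le> \<beta>" and v: "v \<in> carrier_vec n"
  shows "(cholesky Y *\<^sub>v v) \<bullet> (cholesky Y *\<^sub>v v) \<le> \<beta> * (v \<bullet> v)"
proof -
  have "Y \<in> spd n" using Y by (simp add: spectral_band_iff)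
  then have "cholesky Y \<in> carrier_mat n n" using cholesky_spd lower_posD by blast
  then show ?thesis
    using mult_transpose_vec_sq_le[of "transpose_mat (cholesky Y)" n n \<beta> v]
      spectral_band_cholesky(1)[OF Y] b v by auto
qed

lemma spectral_band_cholesky_entry:
  assumes Y: "Y \<in> spectral_band n \<alpha> \<beta>" and ij: "i < n" "j < n"
  shows "\<bar>cholesky Y $$ (i, j)\<bar> \<le> sqrt \<beta>"
proof -
  let ?w = "transpose_mat (cholesky Y) *\<^sub>v unit_vec n i"
  have "Y \<in> spd n" using Y by (simp add: spectral_band_iff)
  then have L: "cholesky Y \<in> carrier_mat n n" using cholesky_spd lower_posD by blast
  have "(cholesky Y $$ (i, j))\<^sup>2 = (?w $ j)\<^sup>2" using L ij by simp
  also have "\<dots> \<le> ?w \<bullet> ?w" using L ij by (intro component_sq_le_scalar_prod) simp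
  also have "\<dots> \<le> \<beta>" using spectral_band_cholesky(1)[OF Y, of "unit_vec n i"] ij by simp
  finally show ?thesis using real_le_rsqrt by fastforce
qed

text \<open>The lower band bound says that \<open>transpose_mat (cholesky Y)\<close> stretches by at
  least \<open>sqrt \<alpha>\<close>. Evaluated at \<open>transpose_mat N *\<^sub>v v\<close>, it
  bounds the transposed inverse, and transposition carries the bound over to
  \<open>N\<close>.\<close>

lemma spectral_band_cholesky_inverse:
  assumes Y: "Y \<in> spectral_band n \<alpha> \<beta>" and a: "0 < \<alpha>"
  obtains N where "N \<in> carrier_mat n n" "N * cholesky Y = 1\<^sub>m n" "cholesky Y * N = 1\<^sub>m n"
    "\<And>v. v \<in> carrier_vec n \<Longrightarrow> (N *\<^sub>v v) \<bullet> (N *\<^sub>v v) \<le> (1 / \<alpha>) * (v \<bullet> v)"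
    "\<And>i j. i < j \<Longrightarrow> j < n \<Longrightarrow> N $$ (i, j) = 0"
proof -
  have "Y \<in> spd n" using Y by (simp add: spectral_band_iff)
  note L = cholesky_spd(1)[OF this] note Lc = lower_posD[OF L]
  obtain N where N: "N \<in> carrier_mat n n" "N * cholesky Y = 1\<^sub>m n" "cholesky Y * N = 1\<^sub>m n"
    using lower_pos_inverse[OF L] .
  have bd: "(transpose_mat N *\<^sub>v v) \<bullet> (transpose_mat N *\<^sub>v v) \<le> (1 / \<alpha>) * (v \<bullet> v)"
    if v: "v \<in> carrier_vec n" for v
  proof -
    let ?u = "transpose_mat N *\<^sub>v v"
    have "transpose_mat (cholesky Y) *\<^sub>v ?u = v"
      using transpose_inverse[OF N(1) Lc(1) N(2)] Lc N v
      by (subst assoc_mult_mat_vec[symmetric, of _ n n _ n]) auto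
    then have "\<alpha> * (?u \<bullet> ?u) \<le> v \<bullet> v"
      using spectral_band_cholesky(2)[OF Y, of ?u] N v by auto
    then show ?thesis using a by (simp add: field_simps)
  qed
  show thesis
  proof (rule that[OF N])
    show "(N *\<^sub>v v) \<bullet> (N *\<^sub>v v) \<le> (1 / \<alpha>) * (v \<bullet> v)" if "v \<in> carrier_vec n" for v
      using mult_transpose_vec_sq_le[of "transpose_mat N" n n "1 / \<alpha>" v] bd N a that by auto
  qed (use lower_triangular_inverse[OF L N(1,3)] in auto)
qed

text \<open>Diagonal entries of a triangular matrix and of its inverse are reciprocal, and those of
  the inverse are bounded by its operator norm.\<close>

lemma spectral_band_cholesky_diag:
  assumes Y: "Y \<in> spectral_band n \<alpha> \<beta>" and a: "0 < \<alpha>" and i: "i < n"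
  shows "sqrt \<alpha> \<le> cholesky Y $$ (i, i)"
proof -
  have "Y \<in> spd n" using Y by (simp add: spectral_band_iff)
  note L = cholesky_spd(1)[OF this] note Lc = lower_posD[OF L]
  obtain N where N: "N \<in> carrier_mat n n" "cholesky Y * N = 1\<^sub>m n"
    and bd: "\<And>v. v \<in> carrier_vec n \<Longrightarrow> (N *\<^sub>v v) \<bullet> (N *\<^sub>v v) \<le> (1 / \<alpha>) * (v \<bullet> v)"
    and Nl: "\<And>i j. i < j \<Longrightarrow> j < n \<Longrightarrow> N $$ (i, j) = 0"
    using spectral_band_cholesky_inverse[OF Y a] by metis
  let ?w = "N *\<^sub>v unit_vec n i"
  have "(N $$ (i, i))\<^sup>2 = (?w $ i)\<^sup>2" using N i by simp
  also have "\<dots> \<le> ?w \<bullet> ?w" using N i by (intro component_sq_le_scalar_prod) simp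
  also have "\<dots> \<le> 1 / \<alpha>" using bd[of "unit_vec n i"] i by simp
  finally have n1: "(N $$ (i, i))\<^sup>2 \<le> 1 / \<alpha>" .
  have one: "cholesky Y $$ (i, i) * N $$ (i, i) = 1"
    using lower_triangular_mult(2)[OF Lc(1) N(1) Lc(2) Nl i] N i by simp
  have "\<alpha> = \<alpha> * (cholesky Y $$ (i, i) * N $$ (i, i))\<^sup>2" by (simp add: one)
  also have "\<dots> \<le> \<alpha> * ((cholesky Y $$ (i, i))\<^sup>2 * (1 / \<alpha>))"
    unfolding power_mult_distrib using a n1 by (intro mult_left_mono) auto
  finally have "\<alpha> \<le> (cholesky Y $$ (i, i))\<^sup>2" using a by simp
  then show ?thesis using Lc(3)[OF i] by (intro real_le_lsqrt) auto
qed

section \<open>Log-Cholesky distance and Frobenius norm on a band\<close>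

lemma dist_LC_triangle:
  assumes "X \<in> spd n" "Y \<in> spd n" "Z \<in> spd n"
  shows "dist_LC X Z \<le> dist_LC X Y + dist_LC Y Z"
proof -
  have "L2_set (\<lambda>p. lc_coord X p - lc_coord Z p) (lc_index n)
    = L2_set (\<lambda>p. (lc_coord X p - lc_coord Y p) + (lc_coord Y p - lc_coord Z p)) (lc_index n)"
    by simp
  also have "\<dots> \<le> L2_set (\<lambda>p. lc_coord X p - lc_coord Y p) (lc_index n)
      + L2_set (\<lambda>p. lc_coord Y p - lc_coord Z p) (lc_index n)"
    by (rule L2_set_triangle_ineq)
  finally show ?thesis using assms by (simp add: dist_LC_eq[of _ n] spdD(1))
qed

text \<open>Both signs come from \<open>ln x \<le> x - 1\<close>, applied to \<open>1 - t\<close>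
  and to its reciprocal. It compares diagonal coordinates, since \<open>M $$ (i, i)\<close> is
  \<open>L $$ (i, i)\<close> times \<open>1 - T $$ (i, i)\<close>.\<close>

lemma abs_ln_one_minus_le:
  fixes t \<epsilon> :: real
  assumes "\<bar>t\<bar> \<le> \<epsilon>" "\<epsilon> < 1"
  shows "\<bar>ln (1 - t)\<bar> \<le> \<bar>t\<bar> / (1 - \<epsilon>)"
proof -
  have pos: "0 < 1 - t" "0 < 1 - \<epsilon>" using assms by auto
  have t: "\<bar>t\<bar> \<le> \<bar>t\<bar> / (1 - \<epsilon>)" using assms pos by (simp add: field_simps mult_left_le)
  have "ln (1 - t) \<le> - t" using ln_le_minus_one[OF pos(1)] by simp
  then have u: "ln (1 - t) \<le> \<bar>t\<bar> / (1 - \<epsilon>)" using t by linarith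
  have "- ln (1 - t) = ln (1 / (1 - t))" using pos by (simp add: ln_div)
  also have "\<dots> \<le> 1 / (1 - t) - 1" using pos by (intro ln_le_minus_one) simp
  also have "\<dots> = t / (1 - t)" using pos by (simp add: field_simps)
  also have "\<dots> \<le> \<bar>t\<bar> / (1 - \<epsilon>)" using assms pos by (intro frac_le) auto
  finally show ?thesis using u by (simp add: abs_le_iff)
qed

text \<open>In the expanded square the cross term \<open>T $$ (i, j) * T $$ (j, i)\<close> is zero
  off the diagonal and a square on it. This is the source of the half in
  \<open>(\<beta> + 1) / 2\<close>.\<close>

lemma lower_triangular_frob_le:
  fixes T :: "real mat"
  assumes T: "T \<in> carrier_mat n n" and l: "\<And>i j. i < j \<Longrightarrow> j < n \<Longrightarrow> T $$ (i, j) = 0"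
  shows "sqrt 2 * frob T \<le> frob (T + transpose_mat T)"
proof -
  have "2 * (frob T)\<^sup>2 = (frob T)\<^sup>2 + (frob (transpose_mat T))\<^sup>2" by (simp add: frob_transpose)
  also have "\<dots> = (\<Sum>i<n. \<Sum>j<n. (T $$ (i, j))\<^sup>2 + (T $$ (j, i))\<^sup>2)"
    using T by (simp add: frob_sq_sum[of _ n n] sum.distrib)
  also have "\<dots> \<le> (\<Sum>i<n. \<Sum>j<n. (T $$ (i, j) + T $$ (j, i))\<^sup>2)"
  proof (intro sum_mono)
    fix i j assume ij: "i \<in> {..<n}" "j \<in> {..<n}"
    consider "i < j" | "i = j" | "j < i" by linarith
    then have "0 \<le> T $$ (i, j) * T $$ (j, i)" using l ij by cases auto
    then show "(T $$ (i, j))\<^sup>2 + (T $$ (j, i))\<^sup>2 \<le> (T $$ (i, j) + T $$ (j, i))\<^sup>2"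
      by (simp add: power2_sum)
  qed
  also have "\<dots> = (frob (T + transpose_mat T))\<^sup>2"
    using T by (simp add: frob_sq_sum[of _ n n])
  finally have "(sqrt 2 * frob T)\<^sup>2 \<le> (frob (T + transpose_mat T))\<^sup>2"
    by (simp add: power_mult_distrib)
  then show ?thesis by (rule power2_le_imp_le) simp
qed

lemma frob_mult_self_transpose_le:
  assumes T: "T \<in> carrier_mat n n"
  shows "frob (T * transpose_mat T) \<le> (frob T)\<^sup>2"
  using frob_mult_le[OF T, of "transpose_mat T" n "(frob T)\<^sup>2"] T mult_mat_vec_sq_le_frob[OF T]
  by (simp add: frob_transpose power2_eq_square)

text \<open>With \<open>L\<close>, \<open>M\<close> the factors of \<open>Y\<close>, \<open>Z\<close> and \<open>T = 1 - L\<^sup>-\<^sup>1 M\<close>, the lower triangular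
  matrix \<open>T\<close> solves \<open>T + T\<^sup>T = L\<^sup>-\<^sup>1 (Y - Z) L\<^sup>-\<^sup>T + T T\<^sup>T\<close>, whose last term is of second order.\<close>

lemma dist_LC_near:
  assumes Y: "Y \<in> spectral_band n \<alpha> \<beta>" and Z: "Z \<in> spectral_band n \<alpha> \<beta>"
    and a: "0 < \<alpha>" and ab: "\<alpha> \<le> \<beta>" and e: "\<epsilon> < 1"
    and small: "frob (cholesky Y - cholesky Z) \<le> \<epsilon> * sqrt \<alpha>"
  shows "(1 - \<epsilon>)\<^sup>2 * dist_LC Y Z \<le> sqrt ((\<beta> + 1) / 2) / \<alpha> * frob (Y - Z)"
proof -
  have Ys: "Y \<in> spd n" and Zs: "Z \<in> spd n" using Y Z by (auto simp: spectral_band_iff)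
  define L where "L = cholesky Y"
  define M where "M = cholesky Z"
  note Lp = cholesky_spd[OF Ys, folded L_def] and Mp = cholesky_spd[OF Zs, folded M_def]
  note Lc = lower_posD[OF Lp(1)] and Mc = lower_posD[OF Mp(1)]
  obtain N where N: "N \<in> carrier_mat n n" "N * L = 1\<^sub>m n" "L * N = 1\<^sub>m n"
    and Nb: "\<And>v. v \<in> carrier_vec n \<Longrightarrow> (N *\<^sub>v v) \<bullet> (N *\<^sub>v v) \<le> (1 / \<alpha>) * (v \<bullet> v)"
    and Nl: "\<And>i j. i < j \<Longrightarrow> j < n \<Longrightarrow> N $$ (i, j) = 0"
    using spectral_band_cholesky_inverse[OF Y a] unfolding L_def by metis
  define R where "R = N * M"
  define T where "T = 1\<^sub>m n - R"
  have R: "R \<in> carrier_mat n n" using N Mc by (simp add: R_def)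
  have T: "T \<in> carrier_mat n n" using R by (simp add: T_def minus_carrier_mat)
  have Tl: "T $$ (i, j) = 0" if "i < j" "j < n" for i j
    using lower_triangular_mult(1)[OF N(1) Mc(1) Nl Mc(2) that] that R by (simp add: T_def flip: R_def)
  have LR: "L * R = M"
    unfolding R_def using assoc_mult_mat[OF Lc(1) N(1) Mc(1)] N(3) Mc(1) by simp
  have LT: "L - M = L * T"
    unfolding T_def using mult_minus_distrib_mat[OF Lc(1) one_carrier_mat R] LR Lc(1) by simp
  have NT: "T = N * (L - M)"
    unfolding T_def R_def using mult_minus_distrib_mat[OF N(1) Lc(1) Mc(1)] N(2) by simp
  define S where "S = N * (Y - Z) * transpose_mat N"
  have S: "S \<in> carrier_mat n n" using N(1) spdD(1)[OF Zs] unfolding S_def by (intro mult_carrier_mat[of _ n n _ n] minus_carrier_mat) auto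
  have "frob S \<le> sqrt (1 / \<alpha>) * frob (N * (Y - Z))"
    unfolding S_def using N(1) spdD(1)[OF Zs] Nb a
    by (intro frob_mult_transpose_le[of _ n n _ n] mult_carrier_mat[of _ n n _ n] minus_carrier_mat) auto
  also have "\<dots> \<le> sqrt (1 / \<alpha>) * (sqrt (1 / \<alpha>) * frob (Y - Z))"
    using N spdD(1)[OF Zs] Nb a
    by (intro mult_left_mono frob_mult_le[of _ n n _ n] minus_carrier_mat) auto
  finally have Sb: "frob S \<le> frob (Y - Z) / \<alpha>"
    using a by (simp flip: mult.assoc)
  \<comment> \<open>Congruence by \<open>N\<close> maps \<open>Y\<close> to the identity and
    \<open>Z\<close> to \<open>R * transpose_mat R\<close>.\<close>
  have SR: "S = 1\<^sub>m n - R * transpose_mat R"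
  proof -
    have "N * X * transpose_mat N = (N * P) * transpose_mat (N * P)"
      if "P \<in> carrier_mat n n" "X = P * transpose_mat P" for X P
    proof -
      have "(N * P) * transpose_mat (N * P) = (N * P) * (transpose_mat P * transpose_mat N)"
        using N that by (simp add: transpose_mult[of N n n P n])
      also have "\<dots> = N * X * transpose_mat N"
        using N that by (simp add: assoc_mult_mat[of _ n n _ n _ n])
      finally show ?thesis by simp
    qed
    from this[OF Lc(1) Lp(2)[symmetric]] this[OF Mc(1) Mp(2)[symmetric]]
    have "N * Y * transpose_mat N = 1\<^sub>m n" "N * Z * transpose_mat N = R * transpose_mat R"
      using N by (auto simp: R_def transpose_one)
    moreover have "S = N * Y * transpose_mat N - N * Z * transpose_mat N"
      using N spdD(1)[OF Ys] spdD(1)[OF Zs]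
      by (simp add: S_def mult_minus_distrib_mat[of _ n n _ n] minus_mult_distrib_mat[of _ n n _ _ n])
    ultimately show ?thesis by simp
  qed
  have TT: "T + transpose_mat T = S + T * transpose_mat T"
  proof (rule eq_matI)
    fix i j assume "i < dim_row (S + T * transpose_mat T)" "j < dim_col (S + T * transpose_mat T)"
    then have ij: "i < n" "j < n" using T by auto
    have RT: "R $$ (i, k) = of_bool (i = k) - T $$ (i, k)" if "i < n" "k < n" for i k
      using that R by (simp add: T_def)
    have delta: "(\<Sum>k<n. of_bool (a = k) * f k) = f a" if "a < n" for a and f :: "nat \<Rightarrow> real"
    proof -
      have "(\<Sum>k<n. of_bool (a = k) * f k) = (\<Sum>k<n. if a = k then f k else 0)"
        by (intro sum.cong) auto
      then show ?thesis using that by simp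
    qed
    have "(R * transpose_mat R) $$ (i, j) = (\<Sum>k<n. R $$ (i, k) * R $$ (j, k))"
      using mult_transpose_index[OF R R] ij by blast
    also have "\<dots> = (\<Sum>k<n. of_bool (i = k) * of_bool (j = k) - of_bool (i = k) * T $$ (j, k)
        - of_bool (j = k) * T $$ (i, k) + T $$ (i, k) * T $$ (j, k))"
      using ij by (intro sum.cong) (auto simp: RT algebra_simps)
    also have "\<dots> = of_bool (i = j) - T $$ (j, i) - T $$ (i, j) + (\<Sum>k<n. T $$ (i, k) * T $$ (j, k))"
      using ij by (simp only: sum.distrib sum_subtractf delta of_bool_eq_iff eq_commute[of j i])
    also have "(\<Sum>k<n. T $$ (i, k) * T $$ (j, k)) = (T * transpose_mat T) $$ (i, j)"
      using mult_transpose_index[OF T T] ij by simp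
    finally show "(T + transpose_mat T) $$ (i, j) = (S + T * transpose_mat T) $$ (i, j)"
      using ij T R by (simp add: SR of_bool_def)
  qed (use T S in auto)
  define \<tau> where "\<tau> = frob T"
  have \<tau>0: "0 \<le> \<tau>" by (simp add: \<tau>_def)
  \<comment> \<open>The scale \<open>sqrt \<alpha>\<close> in the hypothesis \<open>small\<close>
    cancels the operator norm of \<open>N\<close>.\<close>
  have "\<tau> \<le> sqrt (1 / \<alpha>) * frob (L - M)"
    unfolding \<tau>_def NT using N Lc Mc Nb a by (intro frob_mult_le) auto
  also have "\<dots> \<le> sqrt (1 / \<alpha>) * (\<epsilon> * sqrt \<alpha>)"
    using small a by (intro mult_left_mono) (auto simp: L_def M_def)
  finally have \<tau>e: "\<tau> \<le> \<epsilon>" using a by (simp add: real_sqrt_divide)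
  have "sqrt 2 * \<tau> \<le> frob (S + T * transpose_mat T)"
    using lower_triangular_frob_le[OF T Tl] by (simp add: \<tau>_def TT)
  also have "\<dots> \<le> frob S + frob (T * transpose_mat T)"
    using S T by (intro frob_add_le) auto
  also have "\<dots> \<le> frob (Y - Z) / \<alpha> + \<tau>\<^sup>2"
    using Sb frob_mult_self_transpose_le[OF T] by (simp add: \<tau>_def)
  \<comment> \<open>The quadratic term is turned into a small multiple of the left side
    \<open>sqrt 2 * \<tau>\<close> and absorbed there, which costs one factor
    \<open>1 - \<epsilon>\<close>.\<close>
  also have "\<tau>\<^sup>2 \<le> \<epsilon> * \<tau>" using \<tau>e \<tau>0 by (simp add: power2_eq_square mult_right_mono)
  also have "\<epsilon> * \<tau> \<le> sqrt 2 * (\<epsilon> * \<tau>)"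
    using \<tau>0 \<tau>e by (intro mult_right_mono[of 1 "sqrt 2", simplified]) auto
  finally have "(1 - \<epsilon>) * \<tau> * sqrt 2 \<le> frob (Y - Z) / \<alpha>"
    by (simp add: algebra_simps)
  then have key: "(1 - \<epsilon>) * \<tau> \<le> frob (Y - Z) / \<alpha> / sqrt 2"
    by (subst pos_le_divide_eq) auto
  have "frob (L - M) \<le> sqrt \<beta> * \<tau>"
    unfolding LT \<tau>_def using Lc T a ab spectral_band_cholesky_mult_vec[OF Y]
    by (intro frob_mult_le) (auto simp: L_def)
  then have D2: "(frob (L - M))\<^sup>2 \<le> \<beta> * \<tau>\<^sup>2"
    using power_mono[of "frob (L - M)" "sqrt \<beta> * \<tau>" 2] a ab by (simp add: power_mult_distrib)
  \<comment> \<open>Off the diagonal the difference of coordinates is an entry of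
    \<open>L - M\<close>; on the diagonal it is \<open>- ln (1 - T $$ p)\<close>. One common bound
    for both cases allows summing over all positions.\<close>
  have coord: "(lc_coord Y p - lc_coord Z p)\<^sup>2 \<le> ((L - M) $$ p)\<^sup>2 + (T $$ p)\<^sup>2 / (1 - \<epsilon>)\<^sup>2"
    if p: "p \<in> lc_index n" for p
  proof -
    obtain i j where ij: "p = (i, j)" "j \<le> i" "i < n" using p by (auto simp: lc_index_def)
    show ?thesis
    proof (cases "i = j")
      case False
      then show ?thesis using ij Lc(1) Mc(1) by (simp add: lc_coord_def L_def M_def)
    next
      case True
      have Tb: "\<bar>T $$ (i, i)\<bar> \<le> \<epsilon>"
        using abs_entry_le_frob[OF T ij(3) ij(3)] \<tau>e by (simp add: \<tau>_def)
      have "(L - M) $$ (i, i) = L $$ (i, i) * T $$ (i, i)"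
        unfolding LT using lower_triangular_mult(2)[OF Lc(1) T Lc(2) Tl ij(3)] by simp
      then have M: "M $$ (i, i) = L $$ (i, i) * (1 - T $$ (i, i))"
        using Lc Mc ij by (simp add: algebra_simps)
      have "ln (M $$ (i, i)) = ln (L $$ (i, i)) + ln (1 - T $$ (i, i))"
        unfolding M using Lc(3)[OF ij(3)] Tb e by (intro ln_mult_pos) auto
      then have "\<bar>lc_coord Y p - lc_coord Z p\<bar> \<le> \<bar>T $$ p\<bar> / (1 - \<epsilon>)"
        using abs_ln_one_minus_le[OF Tb e] True ij by (simp add: lc_coord_def L_def M_def)
      then have "(lc_coord Y p - lc_coord Z p)\<^sup>2 \<le> (\<bar>T $$ p\<bar> / (1 - \<epsilon>))\<^sup>2"
        by (metis abs_ge_zero power2_abs power_mono)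
      then show ?thesis by (simp add: power_divide add_increasing)
    qed
  qed
  have "(dist_LC Y Z)\<^sup>2 = (\<Sum>p\<in>lc_index n. (lc_coord Y p - lc_coord Z p)\<^sup>2)"
    by (simp add: dist_LC_eq[OF spdD(1)[OF Ys] spdD(1)[OF Zs]] L2_set_def sum_nonneg)
  also have "\<dots> \<le> (\<Sum>p\<in>lc_index n. ((L - M) $$ p)\<^sup>2 + (T $$ p)\<^sup>2 / (1 - \<epsilon>)\<^sup>2)"
    by (intro sum_mono coord)
  also have "\<dots> \<le> (\<Sum>p\<in>{..<n} \<times> {..<n}. ((L - M) $$ p)\<^sup>2 + (T $$ p)\<^sup>2 / (1 - \<epsilon>)\<^sup>2)"
    by (intro sum_mono2) (auto simp: lc_index_def)
  also have "\<dots> = (frob (L - M))\<^sup>2 + \<tau>\<^sup>2 / (1 - \<epsilon>)\<^sup>2"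
    unfolding \<tau>_def frob_sq[OF T] frob_sq[OF minus_carrier_mat[OF Mc(1)]]
    by (simp add: sum.distrib sum_divide_distrib)
  \<comment> \<open>Here \<open>\<beta> + 1\<close> arises: \<beta> from
    \<open>L - M = L * T\<close>, and 1 from the logarithms.\<close>
  also have "\<dots> \<le> \<beta> * (\<tau>\<^sup>2 / (1 - \<epsilon>)\<^sup>2) + \<tau>\<^sup>2 / (1 - \<epsilon>)\<^sup>2"
  proof -
    have "(1 - \<epsilon>)\<^sup>2 \<le> 1" using \<tau>e \<tau>0 e by (intro power_le_one) auto
    then have "\<tau>\<^sup>2 \<le> \<tau>\<^sup>2 / (1 - \<epsilon>)\<^sup>2" using e by (simp add: field_simps mult_left_le)
    then have "\<beta> * \<tau>\<^sup>2 \<le> \<beta> * (\<tau>\<^sup>2 / (1 - \<epsilon>)\<^sup>2)" using a ab by (intro mult_left_mono) auto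
    then show ?thesis using D2 by simp
  qed
  also have "\<dots> = (sqrt (\<beta> + 1) * (\<tau> / (1 - \<epsilon>)))\<^sup>2"
    using a ab by (simp add: power_mult_distrib power_divide add_divide_distrib algebra_simps)
  finally have "dist_LC Y Z \<le> sqrt (\<beta> + 1) * (\<tau> / (1 - \<epsilon>))"
    by (rule power2_le_imp_le) (use a ab e \<tau>0 in auto)
  \<comment> \<open>One factor \<open>1 - \<epsilon>\<close> pays for the logarithm, the other for
    the absorbed quadratic term.\<close>
  then have "(1 - \<epsilon>)\<^sup>2 * dist_LC Y Z \<le> (1 - \<epsilon>)\<^sup>2 * (sqrt (\<beta> + 1) * (\<tau> / (1 - \<epsilon>)))"
    by (intro mult_left_mono) auto
  also have "\<dots> = sqrt (\<beta> + 1) * ((1 - \<epsilon>) * \<tau>)"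
    using e by (simp add: power2_eq_square field_simps)
  also have "\<dots> \<le> sqrt (\<beta> + 1) * (frob (Y - Z) / \<alpha> / sqrt 2)"
    using key a ab by (intro mult_left_mono) auto
  also have "\<dots> = sqrt ((\<beta> + 1) / 2) / \<alpha> * frob (Y - Z)"
    by (simp add: real_sqrt_divide)
  finally show ?thesis .
qed

text \<open>\<delta> depends on the band but not on the pair, so one subdivision makes every step of
  a segment short enough for \<open>dist_LC_near\<close>. The band supplies the entry bounds
  \<open>sqrt \<alpha>\<close> and \<open>sqrt \<beta>\<close> that the perturbation lemma asks
  for.\<close>

lemma spectral_band_cholesky_continuity:
  assumes a: "0 < \<alpha>" and ab: "\<alpha> \<le> \<beta>" and e: "0 < \<epsilon>"
  obtains \<delta> where "0 < \<delta>" "\<And>Y Z. \<lbrakk>Y \<in> spectral_band n \<alpha> \<beta>; Z \<in> spectral_band n \<alpha> \<beta>; frob (Y - Z) \<le> \<delta>\<rbrakk>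
    \<Longrightarrow> frob (cholesky Y - cholesky Z) \<le> \<epsilon>"
proof -
  have "0 < sqrt \<alpha>" "0 \<le> sqrt \<beta>" using a ab by auto
  then show thesis
  proof (rule cholesky_perturbation[where n = n])
    fix C
    assume C: "0 \<le> C" and *: "\<And>L M \<epsilon> i j. \<lbrakk>L \<in> lower_pos n; M \<in> lower_pos n; 0 \<le> \<epsilon>;
      \<And>i. i < n \<Longrightarrow> sqrt \<alpha> \<le> L $$ (i, i) \<and> sqrt \<alpha> \<le> M $$ (i, i);
      \<And>i j. i < n \<Longrightarrow> j < n \<Longrightarrow> \<bar>L $$ (i, j)\<bar> \<le> sqrt \<beta> \<and> \<bar>M $$ (i, j)\<bar> \<le> sqrt \<beta>;
      \<And>i j. i < n \<Longrightarrow> j < n \<Longrightarrow>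
        \<bar>(L * transpose_mat L - M * transpose_mat M) $$ (i, j)\<bar> \<le> \<epsilon>;
      i < n; j < n\<rbrakk> \<Longrightarrow> \<bar>(L - M) $$ (i, j)\<bar> \<le> C * \<epsilon>"
    show thesis
    \<comment> \<open>The factor \<open>real n\<close> passes from entries to the Frobenius norm;
      the added 1 keeps the denominator positive.\<close>
    proof (rule that[of "\<epsilon> / (real n * C + 1)"])
      show "0 < \<epsilon> / (real n * C + 1)" using e C by (simp add: add_nonneg_pos)
      fix Y Z
      assume Y: "Y \<in> spectral_band n \<alpha> \<beta>" and Z: "Z \<in> spectral_band n \<alpha> \<beta>"
        and d: "frob (Y - Z) \<le> \<epsilon> / (real n * C + 1)"
      have Ys: "Y \<in> spd n" and Zs: "Z \<in> spd n" using Y Z by (auto simp: spectral_band_iff)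
      note L = cholesky_spd[OF Ys] and M = cholesky_spd[OF Zs]
      have "\<bar>(cholesky Y - cholesky Z) $$ (i, j)\<bar> \<le> C * frob (Y - Z)" if "i < n" "j < n" for i j
      proof (rule *[OF L(1) M(1)])
        show "\<bar>(cholesky Y * transpose_mat (cholesky Y) - cholesky Z * transpose_mat (cholesky Z)) $$ (i, j)\<bar>
          \<le> frob (Y - Z)" if "i < n" "j < n" for i j
          unfolding L(2) M(2) using spdD(1)[OF Ys] spdD(1)[OF Zs] that
          by (intro abs_entry_le_frob[of _ n n]) auto
      qed (use that a spectral_band_cholesky_diag[OF Y] spectral_band_cholesky_diag[OF Z]
          spectral_band_cholesky_entry[OF Y] spectral_band_cholesky_entry[OF Z] in auto)
      then have "frob (cholesky Y - cholesky Z) \<le> real n * (C * frob (Y - Z))"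
        using lower_posD(1)[OF L(1)] lower_posD(1)[OF M(1)] C by (intro frob_le) auto
      also have "\<dots> \<le> (real n * C + 1) * frob (Y - Z)" by (simp add: algebra_simps)
      also have "\<dots> \<le> (real n * C + 1) * (\<epsilon> / (real n * C + 1))"
        using d C by (intro mult_left_mono) auto
      also have "\<dots> = \<epsilon>"
      proof -
        have "0 < real n * C + 1" using C by (simp add: add_nonneg_pos)
        then show ?thesis by simp
      qed
      finally show "frob (cholesky Y - cholesky Z) \<le> \<epsilon>" .
    qed
  qed
qed

lemma spectral_band_segment:
  assumes Y: "Y \<in> spectral_band n \<alpha> \<beta>" and Z: "Z \<in> spectral_band n \<alpha> \<beta>"
    and a: "0 < \<alpha>" and t: "0 \<le> t" "t \<le> 1"
  shows "(1 - t) \<cdot>\<^sub>m Y + t \<cdot>\<^sub>m Z \<in> spectral_band n \<alpha> \<beta>"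
proof -
  have Ys: "Y \<in> spd n" and Zs: "Z \<in> spd n" using Y Z by (auto simp: spectral_band_iff)
  let ?X = "(1 - t) \<cdot>\<^sub>m Y + t \<cdot>\<^sub>m Z"
  have X: "?X \<in> carrier_mat n n" using spdD(1)[OF Ys] spdD(1)[OF Zs] by simp
  have sym: "A $$ (j, i) = A $$ (i, j)" if "i < n" "j < n" "A \<in> spd n" for i j A
    using that spdD[of A] by (metis carrier_matD index_transpose_mat(1))
  have tr: "transpose_mat ?X = ?X"
    using spdD(1)[OF Ys] spdD(1)[OF Zs] sym[OF _ _ Ys] sym[OF _ _ Zs] by (auto intro!: eq_matI)
  have q: "v \<bullet> (?X *\<^sub>v v) = (1 - t) * (v \<bullet> (Y *\<^sub>v v)) + t * (v \<bullet> (Z *\<^sub>v v))" if "v \<in> carrier_vec n" for v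
    using that spdD(1)[OF Ys] spdD(1)[OF Zs]
    by (simp add: quadratic_form_eq[of _ n] X sum_distrib_left sum.distrib algebra_simps
        flip: sum.distrib sum_subtractf)
  have band: "\<alpha> * (v \<bullet> v) \<le> v \<bullet> (?X *\<^sub>v v) \<and> v \<bullet> (?X *\<^sub>v v) \<le> \<beta> * (v \<bullet> v)" if v: "v \<in> carrier_vec n" for v
  proof -
    have "(1 - t) * (\<alpha> * (v \<bullet> v)) + t * (\<alpha> * (v \<bullet> v)) \<le> v \<bullet> (?X *\<^sub>v v)"
      "v \<bullet> (?X *\<^sub>v v) \<le> (1 - t) * (\<beta> * (v \<bullet> v)) + t * (\<beta> * (v \<bullet> v))"
      unfolding q[OF v] using Y Z v t by (auto simp: spectral_band_iff intro!: add_mono mult_left_mono)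
    then show ?thesis by (simp add: algebra_simps)
  qed
  have "0 < v \<bullet> (?X *\<^sub>v v)" if v: "v \<in> carrier_vec n" "v \<noteq> 0\<^sub>v n" for v
  proof -
    have "0 < v \<bullet> v" using scalar_prod_self_eq_0[of v n] scalar_prod_self_nonneg[of v] v by force
    then have "0 < \<alpha> * (v \<bullet> v)" using a by simp
    then show ?thesis using band[OF v(1)] by simp
  qed
  then show ?thesis using X tr band by (auto simp: spectral_band_iff spd_def)
qed

text \<open>The segment from \<open>Y\<close> to \<open>Z\<close> stays in the band, so the local estimate can be summed over a
  fine subdivision of it; log-Cholesky geodesics may leave the band.\<close>

lemma dist_LC_le_frob:
  assumes Y: "Y \<in> spectral_band n \<alpha> \<beta>" and Z: "Z \<in> spectral_band n \<alpha> \<beta>"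
    and a: "0 < \<alpha>" and ab: "\<alpha> \<le> \<beta>"
  shows "dist_LC Y Z \<le> sqrt ((\<beta> + 1) / 2) / \<alpha> * frob (Y - Z)"
proof (rule field_le_mult_one_interval)
  fix z :: real
  assume z: "0 < z" "z < 1"
  \<comment> \<open>It suffices to prove the bound up to every loss factor \<open>z\<close> below 1.
    This \<epsilon> makes the loss in \<open>dist_LC_near\<close> exactly \<open>z\<close>.\<close>
  define \<epsilon> where "\<epsilon> = 1 - sqrt z"
  have e: "0 < \<epsilon>" "\<epsilon> < 1" "(1 - \<epsilon>)\<^sup>2 = z" using z by (auto simp: \<epsilon>_def)
  let ?K = "sqrt ((\<beta> + 1) / 2) / \<alpha>"
  have "0 < \<epsilon> * sqrt \<alpha>" using e a by simp
  then obtain \<delta> where d: "0 < \<delta>"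
    and \<delta>: "\<And>Y Z. \<lbrakk>Y \<in> spectral_band n \<alpha> \<beta>; Z \<in> spectral_band n \<alpha> \<beta>; frob (Y - Z) \<le> \<delta>\<rbrakk>
      \<Longrightarrow> frob (cholesky Y - cholesky Z) \<le> \<epsilon> * sqrt \<alpha>"
    using spectral_band_cholesky_continuity[OF a ab, where n = n] by blast
  obtain N :: nat where N: "frob (Y - Z) / \<delta> < real N" using reals_Archimedean2 by blast
  then have N0: "0 < N"
    using d by (metis divide_nonneg_pos frob_nonneg gr0I not_less of_nat_0)
  have Ys: "Y \<in> spd n" and Zs: "Z \<in> spd n" using Y Z by (auto simp: spectral_band_iff)
  define P where "P k = (1 - real k / real N) \<cdot>\<^sub>m Y + (real k / real N) \<cdot>\<^sub>m Z" for k
  have P: "P k \<in> spectral_band n \<alpha> \<beta>" if "k \<le> N" for k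
    unfolding P_def using that N0 by (intro spectral_band_segment Y Z a) auto
  have P0: "P 0 = Y" and PN: "P N = Z"
    using spdD(1)[OF Ys] spdD(1)[OF Zs] N0 by (auto simp: P_def intro!: eq_matI)
  have step: "P k - P (Suc k) = (1 / real N) \<cdot>\<^sub>m (Y - Z)" for k
    using spdD(1)[OF Ys] spdD(1)[OF Zs] N0
    by (intro eq_matI) (auto simp: P_def field_simps)
  \<comment> \<open>The Frobenius lengths of the steps add up exactly to
    \<open>frob (Y - Z)\<close>, because the points lie on a straight segment. So the loss
    \<open>z\<close> is incurred once and does not accumulate with the number of steps.\<close>
  have "z * dist_LC (P 0) (P k) \<le> real k * (?K * (frob (Y - Z) / real N))" if "k \<le> N" for k
    using that
  proof (induction k)
    case 0
    have "dist_LC Y Y = 0" by (simp add: dist_LC_eq[of _ n] spdD(1)[OF Ys] L2_set_def)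
    then show ?case by (simp add: P0)
  next
    case (Suc k)
    have fr: "frob (P k - P (Suc k)) = frob (Y - Z) / real N"
      unfolding step frob_smult by simp
    have "z * dist_LC (P k) (P (Suc k)) \<le> ?K * frob (P k - P (Suc k))"
      unfolding e(3)[symmetric]
    proof (rule dist_LC_near[OF P P a ab e(2) \<delta>[OF P P]])
      show "frob (P k - P (Suc k)) \<le> \<delta>" unfolding fr using N N0 d by (simp add: field_simps)
    qed (use Suc.prems in auto)
    moreover have "z * dist_LC (P 0) (P (Suc k)) \<le> z * (dist_LC (P 0) (P k) + dist_LC (P k) (P (Suc k)))"
      using z P Suc.prems
      by (intro mult_left_mono dist_LC_triangle[of _ n]) (auto simp: spectral_band_iff)
    moreover have "z * dist_LC (P 0) (P k) \<le> real k * (?K * (frob (Y - Z) / real N))"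
      using Suc by simp
    ultimately have "z * dist_LC (P 0) (P (Suc k))
        \<le> real k * (?K * (frob (Y - Z) / real N)) + ?K * (frob (Y - Z) / real N)"
      unfolding fr distrib_left by linarith
    then show ?case by (simp only: of_nat_Suc distrib_right mult_1 add.commute)
  qed
  from this[of N] show "z * dist_LC Y Z \<le> ?K * frob (Y - Z)"
    using N0 by (simp add: P0 PN)
qed

text \<open>On the interval from 0 to \<open>c\<close> the logarithm has slope at least
  \<open>1 / c\<close>.\<close>

lemma abs_diff_le_ln:
  fixes a b c :: real
  assumes "0 < a" "0 < b" "a \<le> c" "b \<le> c"
  shows "\<bar>a - b\<bar> \<le> c * \<bar>ln a - ln b\<bar>"
proof -
  have *: "a - b \<le> c * (ln a - ln b)" if "0 < a" "0 < b" "b \<le> a" "a \<le> c" for a b :: real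
  proof -
    have "ln (b / a) \<le> b / a - 1" using that by (intro ln_le_minus_one) simp
    then have "1 - b / a \<le> ln a - ln b" using that by (simp add: ln_div)
    have "a - b = a * (1 - b / a)" using that by (simp add: field_simps)
    also have "\<dots> \<le> a * (ln a - ln b)"
      using \<open>1 - b / a \<le> ln a - ln b\<close> that by (intro mult_left_mono) auto
    also have "\<dots> \<le> c * (ln a - ln b)" using that by (intro mult_right_mono) auto
    finally show ?thesis .
  qed
  show ?thesis
  proof (cases "b \<le> a")
    case True
    then show ?thesis using *[of a b] assms by simp
  next
    case False
    then show ?thesis using *[of b a] assms by (simp add: abs_minus_commute)
  qed
qed

text \<open>Each of the two products in the splitting of \<open>X - Z\<close> costs
  \<open>sqrt \<beta>\<close>, the operator norm bound of a factor. The entries of \<open>D\<close>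
  below the diagonal are coordinate differences; a diagonal entry costs another
  \<open>sqrt \<beta>\<close> to undo the logarithm, whence
  \<open>sqrt (max 1 \<beta>)\<close>.\<close>

lemma frob_le_dist_LC:
  assumes X: "X \<in> spectral_band n \<alpha> \<beta>" and Z: "Z \<in> spectral_band n \<alpha> \<beta>"
    and a: "0 < \<alpha>" and ab: "\<alpha> \<le> \<beta>"
  shows "frob (X - Z) \<le> 2 * sqrt \<beta> * sqrt (max 1 \<beta>) * dist_LC X Z"
proof -
  have Xs: "X \<in> spd n" and Zs: "Z \<in> spd n" using X Z by (auto simp: spectral_band_iff)
  define L where "L = cholesky X"
  define M where "M = cholesky Z"
  note Lp = cholesky_spd[OF Xs, folded L_def] and Mp = cholesky_spd[OF Zs, folded M_def]
  note Lc = lower_posD[OF Lp(1)] and Mc = lower_posD[OF Mp(1)]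
  define D where "D = L - M"
  have D: "D \<in> carrier_mat n n" using Lc Mc by (simp add: D_def minus_carrier_mat)
  have b: "0 \<le> \<beta>" using a ab by simp
  have "X - Z = D * transpose_mat L + M * transpose_mat D"
  proof (rule eq_matI)
    fix i j
    assume "i < dim_row (D * transpose_mat L + M * transpose_mat D)"
      "j < dim_col (D * transpose_mat L + M * transpose_mat D)"
    then have ij: "i < n" "j < n" using D Mc by auto
    have "(X - Z) $$ (i, j) = (\<Sum>k<n. L $$ (i, k) * L $$ (j, k)) - (\<Sum>k<n. M $$ (i, k) * M $$ (j, k))"
      unfolding mult_transpose_index[OF Lc(1) Lc(1) ij, symmetric]
        mult_transpose_index[OF Mc(1) Mc(1) ij, symmetric]
      using ij spdD(1)[OF Zs] by (simp add: Lp(2) Mp(2))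
    also have "\<dots> = (\<Sum>k<n. D $$ (i, k) * L $$ (j, k)) + (\<Sum>k<n. M $$ (i, k) * D $$ (j, k))"
      using ij Lc(1) Mc(1)
      by (simp add: D_def algebra_simps flip: sum.distrib sum_subtractf)
    also have "\<dots> = (D * transpose_mat L + M * transpose_mat D) $$ (i, j)"
      unfolding mult_transpose_index[OF D Lc(1) ij, symmetric]
        mult_transpose_index[OF Mc(1) D ij, symmetric]
      using ij D Mc by simp
    finally show "(X - Z) $$ (i, j) = (D * transpose_mat L + M * transpose_mat D) $$ (i, j)" .
  qed (use D Mc Lc spdD(1)[OF Zs] in auto)
  also have "frob \<dots> \<le> frob (D * transpose_mat L) + frob (M * transpose_mat D)"
    using D Lc Mc by (intro frob_add_le) auto
  also have "\<dots> \<le> sqrt \<beta> * frob D + sqrt \<beta> * frob (transpose_mat D)"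
    using D Lc Mc b spectral_band_cholesky_mult_vec[OF X b] spectral_band_cholesky_mult_vec[OF Z b]
    by (intro add_mono frob_mult_transpose_le frob_mult_le) (auto simp: L_def M_def)
  also have "\<dots> = 2 * sqrt \<beta> * frob D" by (simp add: frob_transpose)
  also have "frob D \<le> sqrt (max 1 \<beta>) * dist_LC X Z"
  proof (rule power2_le_imp_le)
    have "(frob D)\<^sup>2 = (\<Sum>p\<in>lc_index n. (D $$ p)\<^sup>2)"
      unfolding frob_sq[OF D]
    proof (rule sum.mono_neutral_right)
      show "\<forall>p\<in>{..<n} \<times> {..<n} - lc_index n. (D $$ p)\<^sup>2 = 0"
      proof
        fix p assume "p \<in> {..<n} \<times> {..<n} - lc_index n"
        then obtain i j where "p = (i, j)" "i < j" "j < n"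
          by (cases p) (auto simp: lc_index_def not_le)
        then show "(D $$ p)\<^sup>2 = 0" using Lc(1,2) Mc(1,2) by (simp add: D_def)
      qed
    qed (auto simp: lc_index_def)
    also have "\<dots> \<le> (\<Sum>p\<in>lc_index n. max 1 \<beta> * (lc_coord X p - lc_coord Z p)\<^sup>2)"
    proof (rule sum_mono)
      fix p assume "p \<in> lc_index n"
      then obtain i j where ij: "p = (i, j)" "j \<le> i" "i < n" by (auto simp: lc_index_def)
      show "(D $$ p)\<^sup>2 \<le> max 1 \<beta> * (lc_coord X p - lc_coord Z p)\<^sup>2"
      proof (cases "i = j")
        case False
        then have "D $$ p = lc_coord X p - lc_coord Z p"
          using ij Lc(1) Mc(1) by (simp add: lc_coord_def D_def L_def M_def)
        then show ?thesis by (simp add: mult_right_mono[of 1 "max 1 \<beta>", simplified])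
      next
        case True
        have "\<bar>D $$ p\<bar> \<le> sqrt \<beta> * \<bar>lc_coord X p - lc_coord Z p\<bar>"
          using abs_diff_le_ln[OF Lc(3)[OF ij(3)] Mc(3)[OF ij(3)], of "sqrt \<beta>"] True ij Lc(1) Mc(1)
            spectral_band_cholesky_entry[OF X ij(3) ij(3)] spectral_band_cholesky_entry[OF Z ij(3) ij(3)]
          by (simp add: lc_coord_def D_def L_def M_def abs_le_iff)
        then have "\<bar>D $$ p\<bar>\<^sup>2 \<le> (sqrt \<beta> * \<bar>lc_coord X p - lc_coord Z p\<bar>)\<^sup>2"
          by (intro power_mono) auto
        also have "\<dots> = \<beta> * (lc_coord X p - lc_coord Z p)\<^sup>2"
          using b by (simp add: power_mult_distrib)
        also have "\<dots> \<le> max 1 \<beta> * (lc_coord X p - lc_coord Z p)\<^sup>2"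
          by (intro mult_right_mono) auto
        finally show ?thesis by simp
      qed
    qed
    also have "\<dots> = (sqrt (max 1 \<beta>) * dist_LC X Z)\<^sup>2"
      by (simp add: dist_LC_eq[OF spdD(1)[OF Xs] spdD(1)[OF Zs]] L2_set_def sum_nonneg
          power_mult_distrib sum_distrib_left)
    finally show "(frob D)\<^sup>2 \<le> (sqrt (max 1 \<beta>) * dist_LC X Z)\<^sup>2" .
    show "0 \<le> sqrt (max 1 \<beta>) * dist_LC X Z"
      by (simp add: dist_LC_eq[OF spdD(1)[OF Xs] spdD(1)[OF Zs]])
  qed
  finally show ?thesis using b by (simp add: mult_left_mono mult.assoc)
qed

section \<open>The mean layer\<close>

lemma transpose_mult_vec_sq_orthonormal:
  fixes W :: "real mat"
  assumes W: "W \<in> carrier_mat m1 m" and orth: "W * transpose_mat W = 1\<^sub>m m1"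
    and v: "v \<in> carrier_vec m1"
  shows "(transpose_mat W *\<^sub>v v) \<bullet> (transpose_mat W *\<^sub>v v) = v \<bullet> v"
  using gram_quadratic_form[OF W v] v by (simp add: orth)

lemma compression_quadratic_form:
  fixes W :: "real mat"
  assumes W: "W \<in> carrier_mat m1 m" and X: "X \<in> carrier_mat m m" and v: "v \<in> carrier_vec m1"
  shows "v \<bullet> (W * X * transpose_mat W *\<^sub>v v)
    = (transpose_mat W *\<^sub>v v) \<bullet> (X *\<^sub>v (transpose_mat W *\<^sub>v v))"
proof -
  have "W * X * transpose_mat W *\<^sub>v v = W *\<^sub>v (X *\<^sub>v (transpose_mat W *\<^sub>v v))"
    using assoc_mult_mat_vec[of "W * X" m1 m "transpose_mat W" m1 v]
      assoc_mult_mat_vec[of W m1 m X m "transpose_mat W *\<^sub>v v"] W X v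
    by (simp del: assoc_mult_mat)
  then show ?thesis
    using transpose_vec_mult_scalar[OF W, of "X *\<^sub>v (transpose_mat W *\<^sub>v v)" v] W X v by simp
qed

lemma compression_spd:
  assumes W: "W \<in> carrier_mat m1 m" and orth: "W * transpose_mat W = 1\<^sub>m m1" and X: "X \<in> spd m"
  shows "W * X * transpose_mat W \<in> spd m1"
proof -
  note Xc = spdD[OF X]
  have "transpose_mat (W * X * transpose_mat W) = W * X * transpose_mat W"
    using W Xc(1,2) transpose_mult[of "W * X" m1 m "transpose_mat W" m1] transpose_mult[of W m1 m X m]
      assoc_mult_mat[of W m1 m X m "transpose_mat W" m1]
    by (simp del: assoc_mult_mat)
  moreover have "0 < v \<bullet> (W * X * transpose_mat W *\<^sub>v v)" if v: "v \<in> carrier_vec m1" "v \<noteq> 0\<^sub>v m1" for v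
  proof -
    have "(transpose_mat W *\<^sub>v v) \<bullet> (transpose_mat W *\<^sub>v v) \<noteq> 0"
      using transpose_mult_vec_sq_orthonormal[OF W orth v(1)] scalar_prod_self_eq_0[OF v(1)] v(2) by auto
    then have "transpose_mat W *\<^sub>v v \<noteq> 0\<^sub>v m" by auto
    then show ?thesis
      using compression_quadratic_form[OF W Xc(1) v(1)] Xc(3)[of "transpose_mat W *\<^sub>v v"] W v by auto
  qed
  ultimately show ?thesis using W Xc by (auto simp: spd_def)
qed

lemma compression_spectral_band:
  assumes W: "W \<in> carrier_mat m1 m" and orth: "W * transpose_mat W = 1\<^sub>m m1"
    and X: "X \<in> spectral_band m \<alpha> \<beta>"
  shows "W * X * transpose_mat W \<in> spectral_band m1 \<alpha> \<beta>"
proof -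
  have Xs: "X \<in> spd m" using X by (simp add: spectral_band_iff)
  have "\<alpha> * (v \<bullet> v) \<le> v \<bullet> (W * X * transpose_mat W *\<^sub>v v) \<and>
    v \<bullet> (W * X * transpose_mat W *\<^sub>v v) \<le> \<beta> * (v \<bullet> v)" if v: "v \<in> carrier_vec m1" for v
  proof -
    have "transpose_mat W *\<^sub>v v \<in> carrier_vec m" using W v by auto
    then show ?thesis
      using X unfolding compression_quadratic_form[OF W spdD(1)[OF Xs] v] spectral_band_iff
      by (metis transpose_mult_vec_sq_orthonormal[OF W orth v])
  qed
  then show ?thesis using compression_spd[OF W orth Xs] by (simp add: spectral_band_iff)
qed

text \<open>\<open>transpose_mat W\<close> is an isometry, so \<open>W\<close> has operator norm at
  most 1, and it acts once from either side.\<close>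

lemma frob_compression_le:
  assumes W: "W \<in> carrier_mat m1 m" and orth: "W * transpose_mat W = 1\<^sub>m m1"
    and E: "E \<in> carrier_mat m m"
  shows "frob (W * E * transpose_mat W) \<le> frob E"
proof -
  have bd: "(W *\<^sub>v v) \<bullet> (W *\<^sub>v v) \<le> 1 * (v \<bullet> v)" if "v \<in> carrier_vec m" for v
    using mult_transpose_vec_sq_le[of "transpose_mat W" m m1 1 v]
      transpose_mult_vec_sq_orthonormal[OF W orth] W that by simp
  have "frob (W * E * transpose_mat W) \<le> sqrt 1 * frob (W * E)"
    using W E by (intro frob_mult_transpose_le[OF W _ _ bd]) auto
  also have "\<dots> \<le> sqrt 1 * (sqrt 1 * frob E)"
    using W E by (intro mult_left_mono frob_mult_le[OF W _ _ bd]) auto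
  finally show ?thesis by simp
qed

lemma L2_set_sum_le:
  "L2_set (\<lambda>p. \<Sum>h<(H::nat). f h p) A \<le> (\<Sum>h<H. L2_set (f h) A)"
proof (induction H)
  case 0
  show ?case by (simp add: L2_set_def)
next
  case (Suc H)
  have "L2_set (\<lambda>p. \<Sum>h<Suc H. f h p) A \<le> L2_set (\<lambda>p. \<Sum>h<H. f h p) A + L2_set (f H) A"
    using L2_set_triangle_ineq[of "\<lambda>p. \<Sum>h<H. f h p" "f H" A] by simp
  then show ?case using Suc by simp
qed

text \<open>Averaging coordinates is convex combination in a Euclidean space, so the layer inherits
  any bound valid for every single compression.\<close>

lemma dist_LC_frechet_mean_le:
  assumes H: "1 \<le> H" and Ys: "\<And>h. h < H \<Longrightarrow> Ys h \<in> spd n" and Zs: "\<And>h. h < H \<Longrightarrow> Zs h \<in> spd n"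
    and le: "\<And>h. h < H \<Longrightarrow> dist_LC (Ys h) (Zs h) \<le> d"
  shows "dist_LC (frechet_mean_LC n H Ys) (frechet_mean_LC n H Zs) \<le> d"
proof -
  have MY: "frechet_mean_LC n H Ys \<in> spd n"
    "\<And>p. p \<in> lc_index n \<Longrightarrow>
      lc_coord (frechet_mean_LC n H Ys) p = (\<Sum>h<H. lc_coord (Ys h) p) / real H"
    using frechet_mean_LC_coord[of H Ys n] H Ys by auto
  have MZ: "frechet_mean_LC n H Zs \<in> spd n"
    "\<And>p. p \<in> lc_index n \<Longrightarrow>
      lc_coord (frechet_mean_LC n H Zs) p = (\<Sum>h<H. lc_coord (Zs h) p) / real H"
    using frechet_mean_LC_coord[of H Zs n] H Zs by auto
  have "dist_LC (frechet_mean_LC n H Ys) (frechet_mean_LC n H Zs)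
    = L2_set (\<lambda>p. (\<Sum>h<H. lc_coord (Ys h) p - lc_coord (Zs h) p) * (1 / real H)) (lc_index n)"
    unfolding dist_LC_eq[OF spdD(1)[OF MY(1)] spdD(1)[OF MZ(1)]]
    by (intro L2_set_cong refl) (simp add: MY(2) MZ(2) sum_subtractf diff_divide_distrib)
  also have "\<dots> = L2_set (\<lambda>p. \<Sum>h<H. lc_coord (Ys h) p - lc_coord (Zs h) p) (lc_index n) * (1 / real H)"
    by (rule L2_set_left_distrib[symmetric]) simp
  also have "\<dots> \<le> (\<Sum>h<H. L2_set (\<lambda>p. lc_coord (Ys h) p - lc_coord (Zs h) p) (lc_index n)) * (1 / real H)"
    by (intro mult_right_mono L2_set_sum_le) simp
  also have "\<dots> = (\<Sum>h<H. dist_LC (Ys h) (Zs h)) * (1 / real H)"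
    using Ys Zs by (simp add: dist_LC_eq[of _ n] spdD(1))
  also have "\<dots> \<le> (\<Sum>h<H. d) * (1 / real H)"
    using le by (intro mult_right_mono sum_mono) auto
  also have "\<dots> = d" using H by simp
  finally show ?thesis .
qed

text \<open>Without the common factor \<open>2 * sqrt \<beta> / \<alpha>\<close>, the claim is
  \<open>(\<beta> + 1) / 2 * max 1 \<beta> \<le> (\<beta> * max 1 (1 / \<alpha>))\<^sup>2\<close>
  under a root. For \<beta> at least 1, \<open>(\<beta> + 1) / 2\<close> is at most \<beta>. For
  smaller \<beta> the left side is at most 1 and the right side at least 1, because
  \<open>\<beta> / \<alpha>\<close> is.\<close>

lemma lipschitz_constant_bound:
  fixes \<alpha> \<beta> :: real
  assumes a: "0 < \<alpha>" and ab: "\<alpha> \<le> \<beta>"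
  shows "sqrt ((\<beta> + 1) / 2) / \<alpha> * (2 * sqrt \<beta> * sqrt (max 1 \<beta>))
    \<le> 2 * \<beta> powr (3 / 2) / \<alpha> * max 1 (1 / \<alpha>)"
proof -
  have b: "0 < \<beta>" using a ab by simp
  have pw: "\<beta> powr (3 / 2) = \<beta> * sqrt \<beta>"
    using powr_add[of \<beta> 1 "1 / 2"] b by (simp add: powr_half_sqrt)
  have "(\<beta> + 1) / 2 * max 1 \<beta> \<le> (\<beta> * max 1 (1 / \<alpha>))\<^sup>2"
  proof (cases "1 \<le> \<beta>")
    case True
    then have "(\<beta> + 1) / 2 * max 1 \<beta> \<le> \<beta> * \<beta>" by (intro mult_mono) auto
    also have "\<dots> \<le> (\<beta> * max 1 (1 / \<alpha>))\<^sup>2"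
      using b by (simp add: power2_eq_square[symmetric] power_mono)
    finally show ?thesis .
  next
    case False
    then have "(\<beta> + 1) / 2 * max 1 \<beta> \<le> 1" by simp
    also have "1 \<le> \<beta> * max 1 (1 / \<alpha>)"
    proof -
      have "1 \<le> \<beta> * (1 / \<alpha>)" using a ab by (simp add: field_simps)
      also have "\<dots> \<le> \<beta> * max 1 (1 / \<alpha>)" using b by (intro mult_left_mono) auto
      finally show ?thesis .
    qed
    then have "1 \<le> (\<beta> * max 1 (1 / \<alpha>))\<^sup>2" by (simp add: one_le_power)
    finally show ?thesis .
  qed
  then have "sqrt ((\<beta> + 1) / 2 * max 1 \<beta>) \<le> \<beta> * max 1 (1 / \<alpha>)"
    using b by (intro real_le_lsqrt) (auto simp: le_max_iff_disj)
  then have "sqrt ((\<beta> + 1) / 2) * sqrt (max 1 \<beta>) \<le> \<beta> * max 1 (1 / \<alpha>)"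
    by (simp only: real_sqrt_mult)
  then have "(2 * sqrt \<beta> / \<alpha>) * (sqrt ((\<beta> + 1) / 2) * sqrt (max 1 \<beta>))
    \<le> (2 * sqrt \<beta> / \<alpha>) * (\<beta> * max 1 (1 / \<alpha>))"
    using a b by (intro mult_left_mono) auto
  then show ?thesis unfolding pw by (simp add: mult_ac)
qed

section \<open>Single coordinates and the coordinates of the mean layer\<close>

lemma abs_coord_diff_le_dist_LC:
  assumes "X \<in> spd n" "Z \<in> spd n" "p \<in> lc_index n"
  shows "\<bar>lc_coord X p - lc_coord Z p\<bar> \<le> dist_LC X Z"
proof -
  have "(lc_coord X p - lc_coord Z p)\<^sup>2 \<le> (dist_LC X Z)\<^sup>2"
    using assms
    by (simp add: dist_LC_eq[of _ n] spdD(1) L2_set_def sum_nonneg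
        member_le_sum[of p "lc_index n" "\<lambda>p. (lc_coord X p - lc_coord Z p)\<^sup>2"])
  moreover have "0 \<le> dist_LC X Z" using assms by (simp add: dist_LC_eq[of _ n] spdD(1))
  ultimately show ?thesis by (simp add: abs_le_square_iff[symmetric])
qed

text \<open>Provides test pairs with an exactly known distance: two factors that differ in one entry
  only.\<close>

lemma dist_LC_single_coord:
  assumes L: "L \<in> lower_pos n" and M: "M \<in> lower_pos n" and q: "q \<in> lc_index n"
    and eq: "\<And>p. p \<in> lc_index n \<Longrightarrow> p \<noteq> q \<Longrightarrow> L $$ p = M $$ p"
  shows "dist_LC (L * transpose_mat L) (M * transpose_mat M)
    = \<bar>lc_coord (L * transpose_mat L) q - lc_coord (M * transpose_mat M) q\<bar>"
proof -
  let ?X = "L * transpose_mat L" and ?Z = "M * transpose_mat M"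
  have X: "?X \<in> carrier_mat n n" and Z: "?Z \<in> carrier_mat n n"
    using lower_posD(1)[OF L] lower_posD(1)[OF M] by auto
  have "(\<Sum>p\<in>lc_index n. (lc_coord ?X p - lc_coord ?Z p)\<^sup>2)
    = (\<Sum>p\<in>{q}. (lc_coord ?X p - lc_coord ?Z p)\<^sup>2)"
    using q eq by (intro sum.mono_neutral_right)
      (auto simp: lc_coord_def cholesky_mult_transpose[OF L] cholesky_mult_transpose[OF M])
  then show ?thesis by (simp add: dist_LC_eq[OF X Z] L2_set_def)
qed

text \<open>If row \<open>i\<close> of \<open>Y\<close> is zero left of the diagonal, forward
  substitution shows the same for its Cholesky factor. Then \<open>Y $$ (i, i)\<close> is the square
  of one diagonal entry, and the coordinate is known without computing the rest of the
  factor.\<close>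

lemma lc_coord_diag:
  assumes Y: "Y \<in> spd n" and i: "i < n" and z: "\<And>a. a < i \<Longrightarrow> Y $$ (i, a) = 0"
  shows "lc_coord Y (i, i) = ln (Y $$ (i, i)) / 2"
proof -
  define L where "L = cholesky Y"
  note Lp = cholesky_spd[OF Y, folded L_def] note Lc = lower_posD[OF Lp(1)]
  have ent: "Y $$ (i, a) = (\<Sum>k<n. L $$ (i, k) * L $$ (a, k))" if "a < n" for a
    using mult_transpose_index[OF Lc(1) Lc(1) i that] by (simp add: Lp(2))
  have L0: "L $$ (i, a) = 0" if "a < i" for a
    using that
  proof (induction a rule: less_induct)
    case (less a)
    have "0 = (\<Sum>k<n. L $$ (i, k) * L $$ (a, k))" using z[OF less.prems] ent[of a] less.prems i by simp
    also have "\<dots> = (\<Sum>k\<in>{a}. L $$ (i, k) * L $$ (a, k))"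
    proof (rule sum.mono_neutral_right)
      show "\<forall>k\<in>{..<n} - {a}. L $$ (i, k) * L $$ (a, k) = 0"
      proof
        fix k assume "k \<in> {..<n} - {a}"
        then consider "k < a" | "a < k" "k < n" by fastforce
        then show "L $$ (i, k) * L $$ (a, k) = 0" using less Lc(2) by cases auto
      qed
    qed (use less.prems i in auto)
    finally show ?case using Lc(3)[of a] less.prems i by auto
  qed
  have "Y $$ (i, i) = (\<Sum>k\<in>{i}. L $$ (i, k) * L $$ (i, k))"
    unfolding ent[OF i]
  proof (rule sum.mono_neutral_right)
    show "\<forall>k\<in>{..<n} - {i}. L $$ (i, k) * L $$ (i, k) = 0"
    proof
      fix k assume "k \<in> {..<n} - {i}"
      then consider "k < i" | "i < k" "k < n" by fastforce
      then show "L $$ (i, k) * L $$ (i, k) = 0" using L0 Lc(2) by cases auto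
    qed
  qed (use i in auto)
  then have "Y $$ (i, i) = (L $$ (i, i))\<^sup>2" by (simp add: power2_eq_square)
  then show ?thesis using Lc(3)[OF i] by (simp add: lc_coord_def L_def ln_realpow)
qed

lemma compression_mult_transpose_index:
  fixes W L :: "real mat"
  assumes W: "W \<in> carrier_mat m1 m" and L: "L \<in> carrier_mat m m" and ia: "i < m1" "a < m1"
  shows "(W * (L * transpose_mat L) * transpose_mat W) $$ (i, a)
    = (\<Sum>k<m. (W * L) $$ (i, k) * (W * L) $$ (a, k))"
proof -
  have "W * (L * transpose_mat L) * transpose_mat W = (W * L) * transpose_mat (W * L)"
    using W L transpose_mult[of W m1 m L m] assoc_mult_mat[of W m1 m L m "transpose_mat L" m]
      assoc_mult_mat[of "W * L" m1 m "transpose_mat L" m "transpose_mat W" m1]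
    by (simp del: assoc_mult_mat)
  then show ?thesis using mult_transpose_index[of "W * L" m1 m "W * L" m1 i a] W L ia by simp
qed

lemma mean_layer_coord:
  assumes H: "1 \<le> H" and W: "\<And>h. h < H \<Longrightarrow> W h \<in> carrier_mat m1 m"
    and orth: "\<And>h. h < H \<Longrightarrow> W h * transpose_mat (W h) = 1\<^sub>m m1" and X: "X \<in> spd m"
  shows "mean_layer m1 H W X \<in> spd m1"
    and "\<And>p. p \<in> lc_index m1 \<Longrightarrow> lc_coord (mean_layer m1 H W X) p
      = (\<Sum>h<H. lc_coord (W h * X * transpose_mat (W h)) p) / real H"
proof -
  have Y: "W h * X * transpose_mat (W h) \<in> spd m1" if "h < H" for h
    by (rule compression_spd[OF W[OF that] orth[OF that] X])
  show "mean_layer m1 H W X \<in> spd m1"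
    unfolding mean_layer_def by (rule frechet_mean_LC_coord(1)[OF H Y])
  show "lc_coord (mean_layer m1 H W X) p
      = (\<Sum>h<H. lc_coord (W h * X * transpose_mat (W h)) p) / real H" if "p \<in> lc_index m1" for p
    unfolding mean_layer_def by (rule frechet_mean_LC_coord(2)[OF H Y that])
qed

lemma lipschitz_LC_mean_layer:
  assumes H: "1 \<le> H" and W: "\<And>h. h < H \<Longrightarrow> W h \<in> carrier_mat m1 m"
    and orth: "\<And>h. h < H \<Longrightarrow> W h * transpose_mat (W h) = 1\<^sub>m m1"
    and a: "0 < \<alpha>" and ab: "\<alpha> \<le> \<beta>"
  shows "lipschitz_LC (2 * \<beta> powr (3 / 2) / \<alpha> * max 1 (1 / \<alpha>)) (spectral_band m \<alpha> \<beta>)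
    (mean_layer m1 H W)"
  unfolding lipschitz_LC_def
proof (intro conjI ballI)
  let ?C = "2 * \<beta> powr (3 / 2) / \<alpha> * max 1 (1 / \<alpha>)"
  show "0 \<le> ?C" using a by (intro mult_nonneg_nonneg) auto
  fix X Z assume X: "X \<in> spectral_band m \<alpha> \<beta>" and Z: "Z \<in> spectral_band m \<alpha> \<beta>"
  have Xs: "X \<in> spd m" and Zs: "Z \<in> spd m" using X Z by (auto simp: spectral_band_iff)
  show "dist_LC (mean_layer m1 H W X) (mean_layer m1 H W Z) \<le> ?C * dist_LC X Z"
    unfolding mean_layer_def
  proof (rule dist_LC_frechet_mean_le[OF H])
    fix h assume h: "h < H"
    note Wh = W[OF h] orth[OF h]
    show "W h * X * transpose_mat (W h) \<in> spd m1" "W h * Z * transpose_mat (W h) \<in> spd m1"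
      using compression_spd[OF Wh] Xs Zs by auto
    have "W h * X * transpose_mat (W h) - W h * Z * transpose_mat (W h)
      = W h * (X - Z) * transpose_mat (W h)"
      unfolding mult_minus_distrib_mat[OF Wh(1) spdD(1)[OF Xs] spdD(1)[OF Zs]]
      using Wh spdD(1)[OF Xs] spdD(1)[OF Zs]
      by (intro minus_mult_distrib_mat[symmetric, of _ m1 m _ _ m1]) auto
    then have "frob (W h * X * transpose_mat (W h) - W h * Z * transpose_mat (W h)) \<le> frob (X - Z)"
      using frob_compression_le[OF Wh, of "X - Z"] spdD(1)[OF Zs] by (simp add: minus_carrier_mat)
    also have "\<dots> \<le> 2 * sqrt \<beta> * sqrt (max 1 \<beta>) * dist_LC X Z"
      by (rule frob_le_dist_LC[OF X Z a ab])
    finally have *: "sqrt ((\<beta> + 1) / 2) / \<alpha> * frob (W h * X * transpose_mat (W h) - W h * Z * transpose_mat (W h))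
      \<le> sqrt ((\<beta> + 1) / 2) / \<alpha> * (2 * sqrt \<beta> * sqrt (max 1 \<beta>) * dist_LC X Z)"
      using a ab by (intro mult_left_mono) auto
    have "dist_LC (W h * X * transpose_mat (W h)) (W h * Z * transpose_mat (W h))
      \<le> sqrt ((\<beta> + 1) / 2) / \<alpha> * (2 * sqrt \<beta> * sqrt (max 1 \<beta>)) * dist_LC X Z"
      using dist_LC_le_frob[OF compression_spectral_band[OF Wh X] compression_spectral_band[OF Wh Z] a ab] *
      by (simp add: mult.assoc)
    also have "\<dots> \<le> ?C * dist_LC X Z"
      using lipschitz_constant_bound[OF a ab]
      by (intro mult_right_mono) (auto simp: dist_LC_eq[OF spdD(1)[OF Xs] spdD(1)[OF Zs]])
    finally show "dist_LC (W h * X * transpose_mat (W h)) (W h * Z * transpose_mat (W h)) \<le> ?C * dist_LC X Z" .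
  qed
qed

section \<open>Lower bounds for Lipschitz constants on the whole cone\<close>

lemma spd_diag_pos:
  assumes Y: "Y \<in> spd n" and i: "i < n"
  shows "0 < Y $$ (i, i)"
proof -
  note Yc = spdD(1)[OF Y]
  have "unit_vec n i $ i \<noteq> (0\<^sub>v n :: real vec) $ i" using i by simp
  then have "unit_vec n i \<noteq> (0\<^sub>v n :: real vec)" by metis
  then have "0 < unit_vec n i \<bullet> (Y *\<^sub>v unit_vec n i)" using spdD(3)[OF Y] by simp
  also have "\<dots> = (Y *\<^sub>v unit_vec n i) $ i"
    using Yc i by (intro scalar_prod_left_unit[of _ n]) auto
  finally show ?thesis using Yc i by simp
qed

text \<open>Column \<open>i\<close> of the factor \<open>L s \<epsilon>\<close> is \<open>e\<^sub>i + s e\<^sub>j\<close> with \<open>j = j0\<close>, and the later diagonal entries are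
  \<open>\<epsilon>\<close>. At \<open>s0\<close> it is orthogonal to row \<open>i\<close> of \<open>W h0\<close>. Moving \<open>s0\<close> to \<open>s0 + \<epsilon>\<close> has length \<open>\<epsilon>\<close>, but changes
  the \<open>h0\<close> summand by a positive constant; all other changes are nonnegative in the limit.\<close>

lemma mean_layer_not_lipschitz:
  assumes m: "m1 \<le> m" and H: "1 \<le> H"
    and W: "\<And>h. h < H \<Longrightarrow> W h \<in> carrier_mat m1 m"
    and orth: "\<And>h. h < H \<Longrightarrow> W h * transpose_mat (W h) = 1\<^sub>m m1"
    and i: "i < m1"
    and diag: "\<And>h a j. h < H \<Longrightarrow> a < i \<Longrightarrow> j < m \<Longrightarrow> j \<noteq> a \<Longrightarrow> W h $$ (a, j) = 0"
    and h0: "h0 < H" and j0: "j0 < m" "j0 \<noteq> i" and nz: "W h0 $$ (i, j0) \<noteq> 0"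
  shows "\<not> lipschitz_LC K (spd m) (mean_layer m1 H W)"
proof
  assume lip: "lipschitz_LC K (spd m) (mean_layer m1 H W)"
  have im: "i < m" using i m by simp
  \<comment> \<open>By \<open>diag\<close>, row \<open>a\<close> has its only nonzero entry in
    position \<open>a\<close>; orthogonality to that row makes entry \<open>a\<close> of row
    \<open>i\<close> vanish.\<close>
  have Wi: "W h $$ (i, a) = 0" if h: "h < H" and a: "a < i" for h a
  proof -
    have dot: "(\<Sum>k<m. W h $$ (b, k) * W h $$ (a, k)) = of_bool (b = a)" if "b < m1" for b
      using mult_transpose_index[OF W[OF h] W[OF h], of b a] that a i orth[OF h] by auto
    have "(\<Sum>k<m. W h $$ (b, k) * W h $$ (a, k)) = W h $$ (b, a) * W h $$ (a, a)" for b
    proof -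
      have "(\<Sum>k<m. W h $$ (b, k) * W h $$ (a, k)) = (\<Sum>k\<in>{a}. W h $$ (b, k) * W h $$ (a, k))"
        using diag[OF h a] a im by (intro sum.mono_neutral_right) auto
      then show ?thesis by simp
    qed
    then have "W h $$ (i, a) * W h $$ (a, a) = 0" "W h $$ (a, a) * W h $$ (a, a) = 1"
      using dot[of i] dot[of a] i a by auto
    then show ?thesis by auto
  qed
  \<comment> \<open>The parameter \<open>s\<close> therefore sits below the diagonal, so
    \<open>L s \<epsilon>\<close> is a lower triangular factor.\<close>
  have ij0: "i < j0" using Wi[OF h0, of j0] nz j0(2) by (meson nat_neq_iff)
  define L where "L s \<epsilon> = mat m m (\<lambda>(r, c). if r = c then (if r \<le> i then 1 else \<epsilon>)
    else if r = j0 \<and> c = i then s else 0)" for s \<epsilon> :: real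
  define X where "X s \<epsilon> = L s \<epsilon> * transpose_mat (L s \<epsilon>)" for s \<epsilon>
  have L: "L s \<epsilon> \<in> lower_pos m" if "0 < \<epsilon>" for s \<epsilon>
    using that ij0 by (auto simp: L_def lower_pos_def)
  have X: "X s \<epsilon> \<in> spd m" if "0 < \<epsilon>" for s \<epsilon>
    unfolding X_def by (rule lower_pos_mult_transpose_spd[OF L[OF that]])
  \<comment> \<open>The squared norm of row \<open>i\<close> beyond position \<open>i\<close>. The
    columns of \<open>L s \<epsilon>\<close> there are scaled by \<epsilon>, so it enters the
    diagonal entry of the compression with weight \<open>\<epsilon>\<^sup>2\<close>.\<close>
  define q where "q h = (\<Sum>k\<in>{i<..<m}. (W h $$ (i, k))\<^sup>2)" for h
  have WL: "(W h * L s \<epsilon>) $$ (r, k) = W h $$ (r, k) * (if k \<le> i then 1 else \<epsilon>)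
      + (if k = i then W h $$ (r, j0) * s else 0)"
    if h: "h < H" and r: "r < m1" and k: "k < m" for h s \<epsilon> r k
  proof -
    have "(W h * L s \<epsilon>) $$ (r, k) = (\<Sum>c<m. W h $$ (r, c) * L s \<epsilon> $$ (c, k))"
      using mult_index[OF W[OF h] _ r k, of "L s \<epsilon>"] by (simp add: L_def)
    also have "\<dots> = (\<Sum>c<m. (if c = k then W h $$ (r, c) * (if k \<le> i then 1 else \<epsilon>) else 0)
        + (if c = j0 then (if k = i then W h $$ (r, j0) * s else 0) else 0))"
      using k ij0 by (intro sum.cong) (auto simp: L_def)
    also have "\<dots> = W h $$ (r, k) * (if k \<le> i then 1 else \<epsilon>)
      + (if k = i then W h $$ (r, j0) * s else 0)"
      using k j0(1) by (simp add: sum.distrib)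
    finally show ?thesis .
  qed
  have Yspd: "W h * X s \<epsilon> * transpose_mat (W h) \<in> spd m1" if "h < H" "0 < \<epsilon>" for h s \<epsilon>
    by (rule compression_spd[OF W[OF that(1)] orth[OF that(1)] X[OF that(2)]])
  have Yii: "(W h * X s \<epsilon> * transpose_mat (W h)) $$ (i, i)
      = (W h $$ (i, i) + s * W h $$ (i, j0))\<^sup>2 + \<epsilon>\<^sup>2 * q h"
    if h: "h < H" for h s \<epsilon>
  proof -
    have "(W h * X s \<epsilon> * transpose_mat (W h)) $$ (i, i) = (\<Sum>k<m. ((W h * L s \<epsilon>) $$ (i, k))\<^sup>2)"
      using compression_mult_transpose_index[OF W[OF h] _ i i, of "L s \<epsilon>"]
      by (simp add: X_def L_def power2_eq_square)
    also have "\<dots> = (\<Sum>k\<in>insert i {i<..<m}. ((W h * L s \<epsilon>) $$ (i, k))\<^sup>2)"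
      using im Wi[OF h] by (intro sum.mono_neutral_right) (auto simp: WL[OF h i] not_less)
    also have "\<dots> = ((W h * L s \<epsilon>) $$ (i, i))\<^sup>2 + (\<Sum>k\<in>{i<..<m}. ((W h * L s \<epsilon>) $$ (i, k))\<^sup>2)"
      by simp
    also have "(\<Sum>k\<in>{i<..<m}. ((W h * L s \<epsilon>) $$ (i, k))\<^sup>2) = \<epsilon>\<^sup>2 * q h"
      unfolding q_def sum_distrib_left
      by (intro sum.cong) (auto simp: WL[OF h i] power_mult_distrib)
    finally show ?thesis using WL[OF h i im] by (simp add: mult.commute)
  qed
  \<comment> \<open>Row \<open>a\<close> of \<open>W h * L s \<epsilon>\<close> is supported in
    column \<open>a\<close>, where row \<open>i\<close> is zero. This makes
    \<open>lc_coord_diag\<close> applicable.\<close>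
  have Yia: "(W h * X s \<epsilon> * transpose_mat (W h)) $$ (i, a) = 0" if h: "h < H" and a: "a < i" for h s \<epsilon> a
  proof -
    have am: "a < m1" using a i by simp
    have "(W h * X s \<epsilon> * transpose_mat (W h)) $$ (i, a)
      = (\<Sum>k<m. (W h * L s \<epsilon>) $$ (i, k) * (W h * L s \<epsilon>) $$ (a, k))"
      using compression_mult_transpose_index[OF W[OF h] _ i am, of "L s \<epsilon>"] by (simp add: X_def L_def)
    also have "\<dots> = 0"
    proof (rule sum.neutral, rule ballI)
      fix k assume k: "k \<in> {..<m}"
      show "(W h * L s \<epsilon>) $$ (i, k) * (W h * L s \<epsilon>) $$ (a, k) = 0"
      proof (cases "k = a")
        case True
        then show ?thesis using k a Wi[OF h a] by (simp add: WL[OF h i])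
      next
        case False
        then show ?thesis using k a ij0 j0(1) diag[OF h a] by (simp add: WL[OF h am])
      qed
    qed
    finally show ?thesis .
  qed
  define g where "g s \<epsilon> h = ln ((W h $$ (i, i) + s * W h $$ (i, j0))\<^sup>2 + \<epsilon>\<^sup>2 * q h)" for s \<epsilon> h
  have coord: "lc_coord (mean_layer m1 H W (X s \<epsilon>)) (i, i) = (\<Sum>h<H. g s \<epsilon> h) / (2 * real H)"
    if e: "0 < \<epsilon>" for s \<epsilon>
  proof -
    have "lc_coord (mean_layer m1 H W (X s \<epsilon>)) (i, i)
      = (\<Sum>h<H. lc_coord (W h * X s \<epsilon> * transpose_mat (W h)) (i, i)) / real H"
      using mean_layer_coord(2)[OF H W orth X[OF e], where p = "(i, i)"] i by (simp add: lc_index_def)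
    also have "(\<Sum>h<H. lc_coord (W h * X s \<epsilon> * transpose_mat (W h)) (i, i)) = (\<Sum>h<H. g s \<epsilon> h / 2)"
      by (intro sum.cong refl) (use lc_coord_diag[OF Yspd[OF _ e] i Yia] in \<open>simp add: Yii g_def\<close>)
    finally show ?thesis by (simp flip: sum_divide_distrib)
  qed
  define s0 where "s0 = - W h0 $$ (i, i) / W h0 $$ (i, j0)"
  have bound: "(\<Sum>h<H. g (s0 + \<epsilon>) \<epsilon> h - g s0 \<epsilon> h) \<le> 2 * real H * (K * \<epsilon>)" if e: "0 < \<epsilon>" for \<epsilon>
  proof -
    have "dist_LC (X (s0 + \<epsilon>) \<epsilon>) (X s0 \<epsilon>)
      = \<bar>lc_coord (X (s0 + \<epsilon>) \<epsilon>) (j0, i) - lc_coord (X s0 \<epsilon>) (j0, i)\<bar>"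
      unfolding X_def using ij0 j0(1)
      by (intro dist_LC_single_coord[OF L[OF e] L[OF e]]) (auto simp: lc_index_def L_def split: if_splits)
    also have "\<dots> = \<epsilon>"
      using ij0 j0(1) im e
      by (simp add: lc_coord_def X_def cholesky_mult_transpose[OF L[OF e]]) (simp add: L_def)
    finally have d: "dist_LC (X (s0 + \<epsilon>) \<epsilon>) (X s0 \<epsilon>) = \<epsilon>" .
    have "lc_coord (mean_layer m1 H W (X (s0 + \<epsilon>) \<epsilon>)) (i, i)
        - lc_coord (mean_layer m1 H W (X s0 \<epsilon>)) (i, i)
      \<le> dist_LC (mean_layer m1 H W (X (s0 + \<epsilon>) \<epsilon>)) (mean_layer m1 H W (X s0 \<epsilon>))"
      using mean_layer_coord(1)[OF H W orth X[OF e]] i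
      by (intro order_trans[OF abs_ge_self abs_coord_diff_le_dist_LC]) (auto simp: lc_index_def)
    also have "\<dots> \<le> K * dist_LC (X (s0 + \<epsilon>) \<epsilon>) (X s0 \<epsilon>)"
      using lip X[OF e] by (simp add: lipschitz_LC_def)
    also note d
    finally show ?thesis using H by (simp add: coord[OF e] field_simps sum_subtractf)
  qed
  have "\<exists>c\<ge>0. ((\<lambda>\<epsilon>. g (s0 + \<epsilon>) \<epsilon> h - g s0 \<epsilon> h) \<longlongrightarrow> c) (at_right 0) \<and> (h = h0 \<longrightarrow> 0 < c)"
    if h: "h < H" for h
  proof -
    let ?u = "W h $$ (i, i) + s0 * W h $$ (i, j0)" and ?w = "W h $$ (i, j0)"
    show ?thesis
    proof (cases "?u = 0")
      case False
      have "((\<lambda>\<epsilon>. ln ((?u + \<epsilon> * ?w)\<^sup>2 + \<epsilon>\<^sup>2 * q h) - ln (?u\<^sup>2 + \<epsilon>\<^sup>2 * q h))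
          \<longlongrightarrow> ln ((?u + 0 * ?w)\<^sup>2 + 0\<^sup>2 * q h) - ln (?u\<^sup>2 + 0\<^sup>2 * q h)) (at_right 0)"
        using False by (intro tendsto_intros) auto
      then have "((\<lambda>\<epsilon>. g (s0 + \<epsilon>) \<epsilon> h - g s0 \<epsilon> h) \<longlongrightarrow> 0) (at_right 0)"
        by (simp add: g_def algebra_simps)
      moreover have "h \<noteq> h0" using False nz by (auto simp: s0_def)
      ultimately show ?thesis by blast
    next
      case u: True
      \<comment> \<open>At \<epsilon> = 1 the diagonal entry of a positive definite compression
        equals \<open>?u\<^sup>2 + q h\<close>, which here is \<open>q h\<close>.\<close>
      have q0: "0 < q h"
      proof -
        have Y: "W h * X s0 1 * transpose_mat (W h) \<in> spd m1" by (rule Yspd[OF h]) simp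
        show ?thesis using spd_diag_pos[OF Y i] Yii[OF h, of s0 1] u by simp
      qed
      define c where "c = ln (?w\<^sup>2 + q h) - ln (q h)"
      \<comment> \<open>Both arguments of the logarithm are \<open>\<epsilon>\<^sup>2\<close> times
        a fixed number, so the difference does not depend on \<epsilon>, however short the step
        is.\<close>
      have "g (s0 + \<epsilon>) \<epsilon> h - g s0 \<epsilon> h = c" if e: "0 < \<epsilon>" for \<epsilon>
      proof -
        have "g (s0 + \<epsilon>) \<epsilon> h = ln (\<epsilon>\<^sup>2 * (?w\<^sup>2 + q h))"
        proof -
          have "W h $$ (i, i) + (s0 + \<epsilon>) * ?w = \<epsilon> * ?w" using u by (simp add: algebra_simps)
          then show ?thesis by (simp only: g_def power_mult_distrib distrib_left)
        qed
        also have "\<dots> = ln (\<epsilon>\<^sup>2) + ln (?w\<^sup>2 + q h)"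
          using e q0 by (intro ln_mult_pos) (auto simp: add_nonneg_pos)
        finally have "g (s0 + \<epsilon>) \<epsilon> h = ln (\<epsilon>\<^sup>2) + ln (?w\<^sup>2 + q h)" .
        moreover have "g s0 \<epsilon> h = ln (\<epsilon>\<^sup>2) + ln (q h)"
          using e q0 u by (simp add: g_def ln_mult_pos)
        ultimately show ?thesis by (simp add: c_def)
      qed
      then have "((\<lambda>\<epsilon>. g (s0 + \<epsilon>) \<epsilon> h - g s0 \<epsilon> h) \<longlongrightarrow> c) (at_right 0)"
        by (intro tendsto_eventually) (auto simp: eventually_at_right_field intro: exI[of _ 1])
      moreover have "0 \<le> c" using q0 by (simp add: c_def add_nonneg_pos)
      moreover have "0 < c" if "h = h0" using q0 nz that by (simp add: c_def add_pos_pos)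
      ultimately show ?thesis by blast
    qed
  qed
  then have "\<forall>h\<in>{..<H}. \<exists>c. 0 \<le> c \<and>
      ((\<lambda>\<epsilon>. g (s0 + \<epsilon>) \<epsilon> h - g s0 \<epsilon> h) \<longlongrightarrow> c) (at_right 0) \<and> (h = h0 \<longrightarrow> 0 < c)"
    by blast
  from bchoice[OF this] obtain c where c: "\<And>h. h < H \<Longrightarrow> 0 \<le> c h"
    "\<And>h. h < H \<Longrightarrow> ((\<lambda>\<epsilon>. g (s0 + \<epsilon>) \<epsilon> h - g s0 \<epsilon> h) \<longlongrightarrow> c h) (at_right 0)" "0 < c h0"
    using h0 by auto
  \<comment> \<open>As \<epsilon> tends to 0, the changes add up to a positive limit, whereas the
    Lipschitz bound tends to 0.\<close>
  have "((\<lambda>\<epsilon>. \<Sum>h<H. g (s0 + \<epsilon>) \<epsilon> h - g s0 \<epsilon> h) \<longlongrightarrow> (\<Sum>h<H. c h)) (at_right 0)"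
    using c(2) by (intro tendsto_sum) auto
  moreover have "((\<lambda>\<epsilon>. 2 * real H * (K * \<epsilon>)) \<longlongrightarrow> 2 * real H * (K * 0)) (at_right 0)"
    by (intro tendsto_intros)
  moreover have "\<forall>\<^sub>F \<epsilon> in at_right 0. (\<Sum>h<H. g (s0 + \<epsilon>) \<epsilon> h - g s0 \<epsilon> h) \<le> 2 * real H * (K * \<epsilon>)"
    using bound by (auto simp: eventually_at_right_field intro: exI[of _ 1])
  ultimately have "(\<Sum>h<H. c h) \<le> 2 * real H * (K * 0)"
    by (intro tendsto_le[of "at_right (0::real)"]) auto
  moreover have "0 < (\<Sum>h<H. c h)" using c(1,3) h0 by (intro sum_pos2[of _ h0]) auto
  ultimately show False by simp
qed

text \<open>Row 0 of every \<open>W h\<close> is plus or minus the first unit vector. Each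
  compression thus keeps the leading entry of its argument, and moving only the first diagonal
  coordinate of the argument moves that of the image by the same amount.\<close>

lemma mean_layer_diagonal_lipschitz_ge_1:
  assumes m: "m1 \<le> m" and m1: "0 < m1" and H: "1 \<le> H"
    and W: "\<And>h. h < H \<Longrightarrow> W h \<in> carrier_mat m1 m"
    and orth: "\<And>h. h < H \<Longrightarrow> W h * transpose_mat (W h) = 1\<^sub>m m1"
    and diag: "\<And>h j. h < H \<Longrightarrow> j < m \<Longrightarrow> j \<noteq> 0 \<Longrightarrow> W h $$ (0, j) = 0"
    and lip: "lipschitz_LC K (spd m) (mean_layer m1 H W)"
  shows "1 \<le> K"
proof -
  define L where "L t = mat m m (\<lambda>(r, c). if r = c then if r = 0 then exp t else 1 else 0)" for t :: real
  define X where "X t = L t * transpose_mat (L t)" for t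
  have L: "L t \<in> lower_pos m" for t by (auto simp: L_def lower_pos_def)
  have X: "X t \<in> spd m" for t unfolding X_def by (rule lower_pos_mult_transpose_spd[OF L])
  have m0: "0 < m" using m m1 by simp
  have Y: "lc_coord (W h * X t * transpose_mat (W h)) (0, 0) = t" if h: "h < H" for h t
  proof -
    have "(\<Sum>k<m. W h $$ (0, k) * W h $$ (0, k)) = 1"
      using mult_transpose_index[OF W[OF h] W[OF h] m1 m1] orth[OF h] m1 by simp
    moreover have "(\<Sum>k<m. W h $$ (0, k) * W h $$ (0, k)) = (\<Sum>k\<in>{0}. W h $$ (0, k) * W h $$ (0, k))"
      using m0 diag[OF h] by (intro sum.mono_neutral_right) auto
    ultimately have W00: "W h $$ (0, 0) * W h $$ (0, 0) = 1" by simp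
    have WL: "(W h * L t) $$ (0, k) = of_bool (k = 0) * (W h $$ (0, 0) * exp t)" if k: "k < m" for k
    proof -
      have "(W h * L t) $$ (0, k) = (\<Sum>c<m. W h $$ (0, c) * L t $$ (c, k))"
        using mult_index[OF W[OF h] _ m1 k, of "L t"] by (simp add: L_def)
      also have "\<dots> = (\<Sum>c\<in>{0}. W h $$ (0, c) * L t $$ (c, k))"
        using m0 diag[OF h] by (intro sum.mono_neutral_right) auto
      finally show ?thesis using m0 k by (simp add: L_def)
    qed
    have "(W h * X t * transpose_mat (W h)) $$ (0, 0) = (\<Sum>k<m. (W h * L t) $$ (0, k) * (W h * L t) $$ (0, k))"
      using compression_mult_transpose_index[OF W[OF h] _ m1 m1, of "L t"] by (simp add: X_def L_def)
    also have "\<dots> = (\<Sum>k\<in>{0}. (W h * L t) $$ (0, k) * (W h * L t) $$ (0, k))"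
      using m0 by (intro sum.mono_neutral_right) (auto simp: WL)
    also have "\<dots> = exp t * exp t" using W00 m0 by (simp add: WL)
    finally have "(W h * X t * transpose_mat (W h)) $$ (0, 0) = exp (2 * t)" by (simp flip: exp_add)
    moreover have "lc_coord (W h * X t * transpose_mat (W h)) (0, 0)
        = ln ((W h * X t * transpose_mat (W h)) $$ (0, 0)) / 2"
      by (rule lc_coord_diag[OF compression_spd[OF W[OF h] orth[OF h] X] m1]) simp
    ultimately show ?thesis by simp
  qed
  have F: "lc_coord (mean_layer m1 H W (X t)) (0, 0) = t" for t
    using mean_layer_coord(2)[OF H W orth X, where p = "(0, 0)"] m1 H by (simp add: lc_index_def Y)
  have "dist_LC (X 1) (X 0) = \<bar>lc_coord (X 1) (0, 0) - lc_coord (X 0) (0, 0)\<bar>"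
    unfolding X_def using m0 by (intro dist_LC_single_coord[OF L L]) (auto simp: lc_index_def L_def split: if_splits)
  also have "\<dots> = 1"
    using m0 by (simp add: lc_coord_def X_def cholesky_mult_transpose[OF L]) (simp add: L_def)
  finally have d: "dist_LC (X 1) (X 0) = 1" .
  have "1 = \<bar>lc_coord (mean_layer m1 H W (X 1)) (0, 0) - lc_coord (mean_layer m1 H W (X 0)) (0, 0)\<bar>"
    by (simp add: F)
  also have "\<dots> \<le> dist_LC (mean_layer m1 H W (X 1)) (mean_layer m1 H W (X 0))"
    using mean_layer_coord(1)[OF H W orth X] m1
    by (intro abs_coord_diff_le_dist_LC) (auto simp: lc_index_def)
  also have "\<dots> \<le> K * dist_LC (X 1) (X 0)" using lip X by (auto simp: lipschitz_LC_def)
  finally show ?thesis by (simp add: d)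
qed

text \<open>The guard in the last conjunct is essential. If all \<open>W h\<close> vanish off the
  diagonal, each is a diagonal sign matrix padded with zero columns. The layer then keeps the
  leading diagonal coordinates and multiplies the remaining leading ones by averages of signs, which
  is non-expansive, though not contractive.\<close>

theorem proposition3:
  fixes m1 m H :: nat and W :: "nat \<Rightarrow> real mat"
  assumes "1 \<le> m1" and "m1 < m" and "1 \<le> H"
    and "\<And>h. h < H \<Longrightarrow> W h \<in> carrier_mat m1 m"
    and "\<And>h. h < H \<Longrightarrow> W h * transpose_mat (W h) = 1\<^sub>m m1"
  shows "(\<forall>X \<in> spd m. mean_layer m1 H W X \<in> spd m1 \<and>
            mean_layer m1 H W X =
              log_cholesky_inv m1 ((1 / real H) \<cdot>\<^sub>v
                finsum_vec TYPE(real) (m1 * (m1 + 1) div 2)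
                  (\<lambda>h. log_cholesky (W h * X * transpose_mat (W h))) {..<H}))
       \<and> (\<forall>\<alpha> \<beta> :: real. 0 < \<alpha> \<longrightarrow> \<alpha> \<le> \<beta> \<longrightarrow>
            (\<exists>L \<le> 2 * \<beta> powr (3 / 2) / \<alpha> * max 1 (1 / \<alpha>).
               lipschitz_LC L (spectral_band m \<alpha> \<beta>) (mean_layer m1 H W)))
       \<and> \<not> contractive_LC (spd m) (mean_layer m1 H W)
       \<and> ((\<exists>h < H. \<exists>i < m1. \<exists>j < m. i \<noteq> j \<and> W h $$ (i, j) \<noteq> 0) \<longrightarrow>
            \<not> non_expansive_LC (spd m) (mean_layer m1 H W))"
proof -
  note H = assms(3) and W = assms(4) and orth = assms(5)
  let ?F = "mean_layer m1 H W"
  define P where "P i \<longleftrightarrow> i < m1 \<and> (\<exists>h<H. \<exists>j<m. i \<noteq> j \<and> W h $$ (i, j) \<noteq> 0)" for i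
  have nolip: "\<not> lipschitz_LC K (spd m) ?F" if ex: "P i" for i K
  proof -
    define i0 where "i0 = (LEAST i. P i)"
    have "P i0" unfolding i0_def by (rule LeastI[of P, OF ex])
    then obtain h0 j0 where "i0 < m1" "h0 < H" "j0 < m" "j0 \<noteq> i0" "W h0 $$ (i0, j0) \<noteq> 0"
      by (auto simp: P_def)
    moreover have "W h $$ (a, j) = 0" if "h < H" "a < i0" "j < m" "j \<noteq> a" for h a j
      using not_less_Least[of a P] that \<open>i0 < m1\<close> by (auto simp: P_def i0_def)
    ultimately show ?thesis using assms by (intro mean_layer_not_lipschitz) auto
  qed
  have contr: "\<not> contractive_LC (spd m) ?F"
  proof
    assume "contractive_LC (spd m) ?F"
    then obtain K where K: "K < 1" "lipschitz_LC K (spd m) ?F" by (auto simp: contractive_LC_def)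
    \<comment> \<open>A Lipschitz constant exists, so by \<open>nolip\<close> no row can have an
      entry off the diagonal, in particular not row 0.\<close>
    have "W h $$ (0, j) = 0" if "h < H" "j < m" "j \<noteq> 0" for h j
      using nolip[of 0] K(2) that assms(1) by (auto simp: P_def)
    then have "1 \<le> K"
      using assms K(2) by (intro mean_layer_diagonal_lipschitz_ge_1) auto
    with K show False by simp
  qed
  have "?F X \<in> spd m1 \<and> ?F X = log_cholesky_inv m1 ((1 / real H) \<cdot>\<^sub>v
      finsum_vec TYPE(real) (m1 * (m1 + 1) div 2)
        (\<lambda>h. log_cholesky (W h * X * transpose_mat (W h))) {..<H})" if X: "X \<in> spd m" for X
  proof
    show "?F X \<in> spd m1" by (rule mean_layer_coord(1)[OF H W orth X])
    show "?F X = log_cholesky_inv m1 ((1 / real H) \<cdot>\<^sub>v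
      finsum_vec TYPE(real) (m1 * (m1 + 1) div 2)
        (\<lambda>h. log_cholesky (W h * X * transpose_mat (W h))) {..<H})"
      unfolding mean_layer_def
      by (rule frechet_mean_LC_eq_inv[OF H compression_spd[OF W orth X]])
  qed
  moreover have "\<exists>L \<le> 2 * \<beta> powr (3 / 2) / \<alpha> * max 1 (1 / \<alpha>).
      lipschitz_LC L (spectral_band m \<alpha> \<beta>) ?F" if "0 < \<alpha>" "\<alpha> \<le> \<beta>" for \<alpha> \<beta> :: real
    using lipschitz_LC_mean_layer[of H W m1 m \<alpha> \<beta>] H W orth that by blast
  moreover have "\<not> non_expansive_LC (spd m) ?F"
    if "\<exists>h < H. \<exists>i < m1. \<exists>j < m. i \<noteq> j \<and> W h $$ (i, j) \<noteq> 0"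
    using that nolip by (auto simp: non_expansive_LC_def P_def)
  ultimately show ?thesis using contr by blast
qed

end
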